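(* Let $\mathcal I$ be an ideal on $\omega$ and let $X$ be a nonzero Banach space. Then $$c_0\xhookrightarrow{c}c_{0,\mathcal I}(X)\quad\Longleftrightarrow\quad c_0\xhookrightarrow{c}c_{0,\mathcal I}\ \text{ or }\ c_0\xhookrightarrow{c}X.$$ Consequently, if $\mathcal I$ is Grothendieck, then $$c_0\xhookrightarrow{c}c_{0,\mathcal I}(X)\quad\Longleftrightarrow\quad c_0\xhookrightarrow{c}X.$$
   Context: An ideal on $\omega$ is a collection of subsets of $\omega$ containing $\emptyset$, closed under subsets and finite unions; every ideal is assumed to contain all finite sets. $c_{0,\mathcal I}(X)$ is the Banach space (sup norm) of all bounded sequences $(x_n)$ in $X$ with $\{n:\|x_n\|\ge\varepsilon\}\in\mathcal I$ for every $\varepsilon>0$; $c_{0,\mathcal I}$ is the case where $X$ is the scalar field. $Z\xhookrightarrow{c}W$ means that the Banach space $W$ contains a complemented subspace (the range of a bounded linear projection) isomorphic to $Z$. An ideal $\mathcal I$ is Grothendieck if $c_{0,\mathcal I}$ has the Grothendieck property, i.e. every weak$^*$-convergent sequence in $c_{0,\mathcal I}^*$ is weakly convergent. *)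

theory Defs
  imports "HOL-Analysis.Analysis"
begin

section \<open>Banach spaces over the real or complex scalars\<close>

text \<open>
  The sort \<open>{real_normed_field, euclidean_space}\<close> of the scalars has \<open>real\<close> and \<open>complex\<close> as
  instances, and by the Gelfand--Mazur theorem every type of this sort is isometrically
  isomorphic to one of them as a normed field.  Real and complex Banach spaces are therefore
  treated together: the type class supplies the complete norm, the parameter \<open>scale\<close> the scalar
  multiplication.  (Compatibility of \<open>scale\<close> with \<open>scaleR\<close> follows from \<open>norm_scale\<close>.)
\<close>

locale banach_over = vector_space scale
  for scale :: "'k::{real_normed_field,euclidean_space} \<Rightarrow> 'a::banach \<Rightarrow> 'a" +
  assumes norm_scale: "norm (scale c x) = norm c * norm x"

lemma banach_over_scaleR: "banach_over (scaleR :: real \<Rightarrow> 'a::banach \<Rightarrow> 'a)"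
  by unfold_locales (simp_all add: algebra_simps)

lemma banach_over_mult:
  "banach_over ((*) :: 'k::{real_normed_field,euclidean_space} \<Rightarrow> 'k \<Rightarrow> 'k)"
  by unfold_locales (simp_all add: algebra_simps norm_mult)

text \<open>
  Below, a Banach space is given by a closed subspace \<open>W\<close> of a Banach space type together with
  its scalar multiplication; maps and functionals matter only on \<open>W\<close>.
\<close>

definition bounded_linear_on ::
  "('k \<Rightarrow> 'a \<Rightarrow> 'a) \<Rightarrow> ('k \<Rightarrow> 'b \<Rightarrow> 'b) \<Rightarrow> 'a::real_normed_vector set \<Rightarrow>
    ('a \<Rightarrow> 'b::real_normed_vector) \<Rightarrow> bool" where
  "bounded_linear_on s t W f \<longleftrightarrow>
     (\<forall>x\<in>W. \<forall>y\<in>W. f (x + y) = f x + f y) \<and>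
     (\<forall>c. \<forall>x\<in>W. f (s c x) = t c (f x)) \<and>
     (\<exists>K. \<forall>x\<in>W. norm (f x) \<le> K * norm x)"

definition banach_isomorphism ::
  "('k \<Rightarrow> 'a \<Rightarrow> 'a) \<Rightarrow> ('k \<Rightarrow> 'b \<Rightarrow> 'b) \<Rightarrow> 'a::real_normed_vector set \<Rightarrow>
    'b::real_normed_vector set \<Rightarrow> ('a \<Rightarrow> 'b) \<Rightarrow> bool" where
  "banach_isomorphism s t Z Y T \<longleftrightarrow>
     bij_betw T Z Y \<and> bounded_linear_on s t Z T \<and> bounded_linear_on t s Y (inv_into Z T)"

definition complemented_subspace ::
  "('k \<Rightarrow> 'a \<Rightarrow> 'a) \<Rightarrow> 'a::real_normed_vector set \<Rightarrow> 'a set \<Rightarrow> bool" where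
  "complemented_subspace s Y W \<longleftrightarrow>
     Y \<subseteq> W \<and> (\<exists>P. bounded_linear_on s s W P \<and> P ` W = Y \<and> (\<forall>x\<in>W. P (P x) = P x))"

text \<open>\<open>complemented_copy s Z t W\<close> says that \<open>Z\<close> (with scalar multiplication \<open>s\<close>) is isomorphic
  to a complemented subspace of \<open>W\<close> (with scalar multiplication \<open>t\<close>).\<close>

definition complemented_copy ::
  "('k \<Rightarrow> 'a \<Rightarrow> 'a) \<Rightarrow> 'a::real_normed_vector set \<Rightarrow>
    ('k \<Rightarrow> 'b \<Rightarrow> 'b) \<Rightarrow> 'b::real_normed_vector set \<Rightarrow> bool" where
  "complemented_copy s Z t W \<longleftrightarrow>
     (\<exists>Y T. complemented_subspace t Y W \<and> banach_isomorphism s t Z Y T)"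

section \<open>The Grothendieck property\<close>

text \<open>Functionals are normalised to vanish outside \<open>W\<close>, so that each element of the dual space
  is represented by exactly one function and the dual is closed under pointwise operations.\<close>

definition dual_space ::
  "('k::real_normed_field \<Rightarrow> 'a \<Rightarrow> 'a) \<Rightarrow> 'a::real_normed_vector set \<Rightarrow> ('a \<Rightarrow> 'k) set" where
  "dual_space s W = {f. bounded_linear_on s (*) W f \<and> (\<forall>x. x \<notin> W \<longrightarrow> f x = 0)}"

definition dual_norm ::
  "'a::real_normed_vector set \<Rightarrow> ('a \<Rightarrow> 'k::real_normed_field) \<Rightarrow> real" where
  "dual_norm W f = (SUP x\<in>{x \<in> W. norm x \<le> 1}. norm (f x))"

definition bidual_functional ::
  "('k::real_normed_field \<Rightarrow> 'a \<Rightarrow> 'a) \<Rightarrow> 'a::real_normed_vector set \<Rightarrow>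
    (('a \<Rightarrow> 'k) \<Rightarrow> 'k) \<Rightarrow> bool" where
  "bidual_functional s W \<phi> \<longleftrightarrow>
     (\<forall>f\<in>dual_space s W. \<forall>g\<in>dual_space s W. \<phi> (\<lambda>x. f x + g x) = \<phi> f + \<phi> g) \<and>
     (\<forall>c. \<forall>f\<in>dual_space s W. \<phi> (\<lambda>x. c * f x) = c * \<phi> f) \<and>
     (\<exists>K. \<forall>f\<in>dual_space s W. norm (\<phi> f) \<le> K * dual_norm W f)"

definition weak_star_convergent ::
  "('k::real_normed_field \<Rightarrow> 'a \<Rightarrow> 'a) \<Rightarrow> 'a::real_normed_vector set \<Rightarrow>
    (nat \<Rightarrow> 'a \<Rightarrow> 'k) \<Rightarrow> bool" where
  "weak_star_convergent s W f \<longleftrightarrow>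
     (\<exists>g\<in>dual_space s W. \<forall>x\<in>W. (\<lambda>n. f n x) \<longlonglongrightarrow> g x)"

definition weakly_convergent ::
  "('k::real_normed_field \<Rightarrow> 'a \<Rightarrow> 'a) \<Rightarrow> 'a::real_normed_vector set \<Rightarrow>
    (nat \<Rightarrow> 'a \<Rightarrow> 'k) \<Rightarrow> bool" where
  "weakly_convergent s W f \<longleftrightarrow>
     (\<exists>g\<in>dual_space s W. \<forall>\<phi>. bidual_functional s W \<phi> \<longrightarrow> (\<lambda>n. \<phi> (f n)) \<longlonglongrightarrow> \<phi> g)"

definition grothendieck_property ::
  "('k::real_normed_field \<Rightarrow> 'a \<Rightarrow> 'a) \<Rightarrow> 'a::real_normed_vector set \<Rightarrow> bool" where
  "grothendieck_property s W \<longleftrightarrow>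
     (\<forall>f. (\<forall>n. f n \<in> dual_space s W) \<longrightarrow> weak_star_convergent s W f \<longrightarrow> weakly_convergent s W f)"

section \<open>Ideals and the associated sequence spaces\<close>

text \<open>The improper ideal of all sets is allowed.\<close>

definition ideal_on_omega :: "nat set set \<Rightarrow> bool" where
  "ideal_on_omega \<I> \<longleftrightarrow>
     {} \<in> \<I> \<and> (\<forall>A\<in>\<I>. \<forall>B\<subseteq>A. B \<in> \<I>) \<and> (\<forall>A\<in>\<I>. \<forall>B\<in>\<I>. A \<union> B \<in> \<I>) \<and> (\<forall>A. finite A \<longrightarrow> A \<in> \<I>)"

text \<open>As \<open>nat\<close> is discrete, the type \<open>nat \<Rightarrow>\<^sub>C 'a\<close> of bounded continuous functions is the space of
  all bounded sequences with the sup norm.\<close>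

definition scale_seq ::
  "('k \<Rightarrow> 'a \<Rightarrow> 'a) \<Rightarrow> 'k \<Rightarrow> (nat \<Rightarrow>\<^sub>C 'a::real_normed_vector) \<Rightarrow> (nat \<Rightarrow>\<^sub>C 'a)" where
  "scale_seq s c x = Bcontfun (\<lambda>n. s c (apply_bcontfun x n))"

lemma (in banach_over) apply_scale_seq:
  "apply_bcontfun (scale_seq scale c x) n = scale c (apply_bcontfun x n)"
proof -
  have "bounded (range (\<lambda>n. scale c (apply_bcontfun x n)))"
    unfolding bounded_iff
    by (rule exI[of _ "norm c * norm x"]) (auto simp: norm_scale norm_bounded mult_left_mono)
  then have "(\<lambda>n. scale c (apply_bcontfun x n)) \<in> bcontfun"
    by (simp add: bcontfun_def)
  then show ?thesis
    by (simp add: scale_seq_def Bcontfun_inverse)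
qed

definition c0_ideal :: "nat set set \<Rightarrow> (nat \<Rightarrow>\<^sub>C 'a::real_normed_vector) set" where
  "c0_ideal \<I> = {x. \<forall>\<epsilon>>0. {n. norm (apply_bcontfun x n) \<ge> \<epsilon>} \<in> \<I>}"

definition c0 :: "(nat \<Rightarrow>\<^sub>C 'k::real_normed_field) set" where
  "c0 = {x. apply_bcontfun x \<longlonglongrightarrow> 0}"

text \<open>The type argument fixes the scalar field of the space of scalar sequences.\<close>

definition grothendieck_ideal ::
  "'k::{real_normed_field,euclidean_space} itself \<Rightarrow> nat set set \<Rightarrow> bool" where
  "grothendieck_ideal _ \<I> \<longleftrightarrow>
     grothendieck_property (scale_seq (*)) (c0_ideal \<I> :: (nat \<Rightarrow>\<^sub>C 'k) set)"

end

theory Submission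
  imports Defs
begin

text \<open>
  A complemented copy of \<open>c\<^sub>0\<close> in \<open>W\<close> amounts to a weakly unconditionally Cauchy series \<open>x\<close> in \<open>W\<close>
  and a bounded weak*-null sequence \<open>f\<close> of functionals with \<open>f n (x n)\<close> not tending to zero:
  along a subsequence the matrix \<open>f n (x m)\<close> is a small perturbation of an invertible diagonal one.
  This makes the passage from \<open>X\<close> or from the scalar space to the vector-valued space easy.

  For the converse, cut the \<open>x n\<close> down to sets of indices. If, for some \<open>C\<close> in the ideal and some
  \<open>B n \<subseteq> C\<close>, the values of \<open>f n\<close> on \<open>x n\<close> restricted to \<open>B n\<close> do not tend to zero, but
  \<open>c\<^sub>0\<close> is not complemented in \<open>X\<close>, then finitely many coordinates never matter. So the \<open>k\<close>-th
  restriction may be moved beyond \<open>k\<close>, after which the series can be summed pointwise with arbitrary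
  bounded coefficients. This gives an operator from \<open>\<ell>\<^sub>\<infinity>\<close> to \<open>c\<^sub>0\<close> which Phillips' lemma forbids.
  Otherwise the \<open>x n\<close> can be cut down to disjoint sets without losing the values, and a disjoint
  sequence in the vector-valued space is modelled by its norms in the scalar one.

  If the scalar space is Grothendieck, summing functionals over the series \<open>x\<close> is an element of the
  bidual which separates \<open>f\<close> from its weak* limit zero.
\<close>

section \<open>Subsequences of scalar matrices\<close>

text \<open>Recursive choice of \<open>r\<close>: at each stage only finitely many eventual
  conditions have to hold, so one of the frequently many \<open>n\<close> with \<open>P n\<close>
  meets them all. The first argument of \<open>Q\<close> is the position in the subsequence, which
  lets tolerances shrink along it.\<close>

lemma frequently_subsequence:
  fixes Q :: "nat \<Rightarrow> nat \<Rightarrow> nat \<Rightarrow> bool"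
  assumes "\<exists>\<^sub>F n in sequentially. P n"
    and "\<And>k i. \<forall>\<^sub>F n in sequentially. Q k i n"
  shows "\<exists>r::nat \<Rightarrow> nat. strict_mono r \<and> (\<forall>k. P (r k)) \<and> (\<forall>j k. j < k \<longrightarrow> Q k (r j) (r k))"
proof -
  \<comment> \<open>All \<open>i \<le> x\<close> are treated, not only the indices chosen before, so
    the recursion has to remember just the last term.\<close>
  have next_ex: "\<exists>y. P y \<and> x < y \<and> (\<forall>i\<le>x. Q (Suc k) i y)" for x k
  proof -
    have "\<forall>\<^sub>F n in sequentially. x < n \<and> (\<forall>i\<in>{..x}. Q (Suc k) i n)"
      using assms(2) eventually_gt_at_top[of x]
      by (intro eventually_conj eventually_ball_finite) auto
    then have "\<exists>\<^sub>F n in sequentially. P n \<and> x < n \<and> (\<forall>i\<in>{..x}. Q (Suc k) i n)"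
      by (intro frequently_rev_mp[OF assms(1)]) (auto elim: eventually_mono)
    from frequently_ex[OF this] show ?thesis by auto
  qed
  have "\<exists>r. \<forall>k. P (r k) \<and> (r k < r (Suc k) \<and> (\<forall>i\<le>r k. Q (Suc k) i (r (Suc k))))"
  proof (rule dependent_nat_choice)
    show "\<exists>x. P x" using assms(1) by (rule frequently_ex)
  qed (use next_ex in blast)
  then obtain r :: "nat \<Rightarrow> nat" where r: "\<And>k. P (r k)" "\<And>k. r k < r (Suc k)"
    "\<And>k i. i \<le> r k \<Longrightarrow> Q (Suc k) i (r (Suc k))" by blast
  have mono: "strict_mono r" using r(2) by (simp add: strict_mono_Suc_iff)
  have "Q k (r j) (r k)" if "j < k" for j k
  proof -
    from that obtain l where k: "k = Suc l" "j \<le> l" by (cases k) auto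
    then have "r j \<le> r l" using mono by (simp add: strict_mono_less_eq)
    then show ?thesis using r(3) k by blast
  qed
  then show ?thesis using mono r(1) by blast
qed

lemma not_tendsto_zeroE:
  fixes g :: "nat \<Rightarrow> 'a::real_normed_vector"
  assumes "\<not> g \<longlonglongrightarrow> 0"
  obtains \<delta> where "\<delta> > 0" "\<exists>\<^sub>F n in sequentially. \<delta> \<le> norm (g n)"
proof -
  obtain \<delta> where "\<delta> > 0" "\<not> (\<forall>\<^sub>F n in sequentially. norm (g n) < \<delta>)"
    using assms by (auto simp: tendsto_iff)
  then show ?thesis using that by (auto simp: frequently_def not_le)
qed

lemma sum_half_power_le:
  assumes "finite (F :: nat set)" shows "(\<Sum>m\<in>F. (1/2)^(m+1)) \<le> (1::real)"
proof -
  have s: "(\<lambda>m. (1/2::real)^(m+1)) sums 1"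
    using power_half_series by simp
  show ?thesis
    using sum_le_suminf[OF sums_summable[OF s] assms] sums_unique[OF s] by simp
qed

text \<open>Each newly chosen index makes its row and column entries against all earlier indices at
  most \<epsilon> times \<open>(1/2)^(k+1)\<close>, \<open>k\<close> being its position; the
  off-diagonal row sums are then dominated by a geometric series.\<close>

lemma small_off_diagonal_subsequence:
  fixes a :: "nat \<Rightarrow> nat \<Rightarrow> 'a::real_normed_vector"
  assumes rows: "\<And>i. (\<lambda>n. a i n) \<longlonglongrightarrow> 0" and cols: "\<And>i. (\<lambda>n. a n i) \<longlonglongrightarrow> 0"
    and freq: "\<exists>\<^sub>F n in sequentially. P n" and "\<epsilon> > 0"
  shows "\<exists>r::nat \<Rightarrow> nat. strict_mono r \<and> (\<forall>k. P (r k)) \<and>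
    (\<forall>j F. finite F \<longrightarrow> j \<notin> F \<longrightarrow> (\<Sum>m\<in>F. norm (a (r j) (r m))) \<le> \<epsilon>)"
proof -
  let ?e = "\<lambda>k::nat. \<epsilon> * (1/2)^(k+1)"
  have "\<forall>\<^sub>F n in sequentially. norm (a i n) \<le> ?e k \<and> norm (a n i) \<le> ?e k" for k i
  proof (rule eventually_conj)
    have e: "?e k > 0" using \<open>\<epsilon> > 0\<close> by simp
    show "\<forall>\<^sub>F n in sequentially. norm (a i n) \<le> ?e k"
      using tendstoD[OF rows[of i] e] by eventually_elim simp
    show "\<forall>\<^sub>F n in sequentially. norm (a n i) \<le> ?e k"
      using tendstoD[OF cols[of i] e] by eventually_elim simp
  qed
  then have "\<exists>r. strict_mono r \<and> (\<forall>k. P (r k)) \<and>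
      (\<forall>j k. j < k \<longrightarrow> norm (a (r j) (r k)) \<le> ?e k \<and> norm (a (r k) (r j)) \<le> ?e k)"
    by (rule frequently_subsequence[OF freq])
  then obtain r :: "nat \<Rightarrow> nat" where r: "strict_mono r" "\<And>k. P (r k)"
    "\<And>j k. j < k \<Longrightarrow> norm (a (r j) (r k)) \<le> ?e k \<and> norm (a (r k) (r j)) \<le> ?e k"
    by blast
  \<comment> \<open>The bound is attached to the later of the two positions; if that is
    \<open>j\<close>, it is still below the one for \<open>m\<close>.\<close>
  have e: "norm (a (r j) (r m)) \<le> ?e m" if "j \<noteq> m" for j m
  proof (cases "j < m")
    case False
    then have "norm (a (r j) (r m)) \<le> ?e j" using that r(3) by auto
    also have "\<dots> \<le> ?e m" using False \<open>\<epsilon> > 0\<close>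
      by (intro mult_left_mono power_decreasing) auto
    finally show ?thesis .
  qed (use r(3) in auto)
  have "(\<Sum>m\<in>F. norm (a (r j) (r m))) \<le> \<epsilon>" if "finite F" "j \<notin> F" for j F
  proof -
    have "(\<Sum>m\<in>F. norm (a (r j) (r m))) \<le> (\<Sum>m\<in>F. ?e m)"
      using that(2) by (intro sum_mono e) auto
    also have "\<dots> = \<epsilon> * (\<Sum>m\<in>F. (1/2)^(m+1))" by (rule sum_distrib_left[symmetric])
    also have "\<dots> \<le> \<epsilon> * 1"
      using sum_half_power_le[OF that(1)] \<open>\<epsilon> > 0\<close> by (intro mult_left_mono) auto
    also have "\<dots> = \<epsilon>" by simp
    finally show ?thesis .
  qed
  then show ?thesis using r by blast
qed

section \<open>Bounded sequences\<close>

text \<open>The library instance requires a metric domain, and \<open>nat\<close> is not an instance of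
  \<open>metric_space\<close>.\<close>

instance bcontfun :: (topological_space, complete_space) complete_space
proof
  fix f :: "nat \<Rightarrow> ('a, 'b) bcontfun"
  assume "Cauchy f"
  then obtain g where "uniform_limit UNIV f g sequentially"
    using uniformly_convergent_eq_cauchy[of "\<lambda>_. True" f]
    unfolding Cauchy_def uniform_limit_sequentially_iff
    by (metis dist_fun_lt_imp_dist_val_lt)
  from uniform_limit_bcontfunE[OF this sequentially_bot] show "convergent f"
    by (metis convergentI)
qed

instance bcontfun :: (topological_space, banach) banach ..

lemma apply_Bcontfun:
  fixes g :: "nat \<Rightarrow> 'a::real_normed_vector"
  assumes "\<And>i. norm (g i) \<le> K"
  shows "apply_bcontfun (Bcontfun g) = g"
  by (rule Bcontfun_inverse) (rule bcontfun_normI[OF _ assms], simp)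

lemma apply_bcontfun_sum:
  "apply_bcontfun (\<Sum>i\<in>A. f i) n = (\<Sum>i\<in>A. apply_bcontfun (f i) n)"
  by (induct A rule: infinite_finite_induct) auto

section \<open>Restriction of a sequence to a set of indices\<close>

definition mask :: "nat set \<Rightarrow> (nat \<Rightarrow>\<^sub>C 'a::real_normed_vector) \<Rightarrow> (nat \<Rightarrow>\<^sub>C 'a)" where
  "mask A x = Bcontfun (\<lambda>i. if i \<in> A then apply_bcontfun x i else 0)"

lemma apply_mask [simp]: "apply_bcontfun (mask A x) i = (if i \<in> A then apply_bcontfun x i else 0)"
  unfolding mask_def by (subst apply_Bcontfun[of _ "norm x"]) (auto simp: norm_bounded)

lemma mask_empty [simp]: "mask {} x = 0" and mask_UNIV [simp]: "mask UNIV x = x"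
  by (auto intro!: bcontfun_eqI)

lemma mask_mask [simp]: "mask A (mask B x) = mask (A \<inter> B) x"
  by (rule bcontfun_eqI) auto

lemma mask_Un_disjoint: "A \<inter> B = {} \<Longrightarrow> mask (A \<union> B) x = mask A x + mask B x"
  by (rule bcontfun_eqI) auto

lemma mask_finite: "finite F \<Longrightarrow> mask F x = (\<Sum>i\<in>F. mask {i} x)"
proof (induct F rule: finite_induct)
  case (insert i F)
  then show ?case using mask_Un_disjoint[of "{i}" F x] by simp
qed simp

abbreviation unit_seq :: "nat \<Rightarrow> (nat \<Rightarrow>\<^sub>C 'k::real_normed_field)" where
  "unit_seq n \<equiv> mask {n} (const_bcontfun 1)"

section \<open>Ideals and sequences tending to zero along them\<close>

lemma c0_idealI: "(\<And>e. e > 0 \<Longrightarrow> {n. e \<le> norm (apply_bcontfun x n)} \<in> \<I>) \<Longrightarrow> x \<in> c0_ideal \<I>"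
  and c0_idealD: "x \<in> c0_ideal \<I> \<Longrightarrow> e > 0 \<Longrightarrow> {n. e \<le> norm (apply_bcontfun x n)} \<in> \<I>"
  by (auto simp: c0_ideal_def)

lemma ideal_subset: "ideal_on_omega \<I> \<Longrightarrow> A \<in> \<I> \<Longrightarrow> B \<subseteq> A \<Longrightarrow> B \<in> \<I>"
  and ideal_Un: "ideal_on_omega \<I> \<Longrightarrow> A \<in> \<I> \<Longrightarrow> B \<in> \<I> \<Longrightarrow> A \<union> B \<in> \<I>"
  and ideal_finite: "ideal_on_omega \<I> \<Longrightarrow> finite A \<Longrightarrow> A \<in> \<I>"
  by (auto simp: ideal_on_omega_def)

lemma ideal_UN:
  assumes "ideal_on_omega \<I>" "finite F" "\<And>i. i \<in> F \<Longrightarrow> A i \<in> \<I>"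
  shows "(\<Union>i\<in>F. A i) \<in> \<I>"
  using assms(2,3)
proof (induct F rule: finite_induct)
  case empty
  then show ?case using assms(1) by (simp add: ideal_finite)
next
  case (insert i F)
  then show ?case using assms(1) by (simp add: ideal_Un)
qed

lemma c0_ideal_dominated:
  assumes "ideal_on_omega \<I>" "x \<in> c0_ideal \<I>"
    and "\<And>i. norm (apply_bcontfun y i) \<le> norm (apply_bcontfun x i)"
  shows "y \<in> c0_ideal \<I>"
proof (rule c0_idealI)
  fix e :: real assume "e > 0"
  have "{n. e \<le> norm (apply_bcontfun y n)} \<subseteq> {n. e \<le> norm (apply_bcontfun x n)}"
    using assms(3) order_trans by blast
  then show "{n. e \<le> norm (apply_bcontfun y n)} \<in> \<I>"
    using ideal_subset c0_idealD assms(1,2) \<open>e > 0\<close> by blast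
qed

lemma c0_ideal_supported:
  assumes "ideal_on_omega \<I>" "C \<in> \<I>" "\<And>i. i \<notin> C \<Longrightarrow> apply_bcontfun x i = 0"
  shows "x \<in> c0_ideal \<I>"
proof (rule c0_idealI)
  fix e :: real assume "e > 0"
  then have "{n. e \<le> norm (apply_bcontfun x n)} \<subseteq> C" using assms(3) by force
  then show "{n. e \<le> norm (apply_bcontfun x n)} \<in> \<I>" using ideal_subset assms(1,2) by blast
qed

lemma mask_in_c0_ideal: "ideal_on_omega \<I> \<Longrightarrow> x \<in> c0_ideal \<I> \<Longrightarrow> mask A x \<in> c0_ideal \<I>"
  by (erule c0_ideal_dominated) auto

text \<open>Where the limit has norm at least \<open>e\<close>, a term within \<open>e/2\<close> of
  it has norm at least \<open>e/2\<close>.\<close>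

lemma closed_c0_ideal:
  assumes "ideal_on_omega \<I>" shows "closed (c0_ideal \<I>)"
  unfolding closed_sequential_limits
proof safe
  fix x and l :: "nat \<Rightarrow>\<^sub>C 'a" assume x: "\<forall>n. x n \<in> c0_ideal \<I>" and lim: "x \<longlonglongrightarrow> l"
  show "l \<in> c0_ideal \<I>"
  proof (rule c0_idealI)
    fix e :: real assume "e > 0"
    then obtain n where n: "dist (x n) l < e/2"
      using tendstoD[OF lim, of "e/2"] by (auto simp: eventually_sequentially)
    have "{i. e \<le> norm (apply_bcontfun l i)} \<subseteq> {i. e/2 \<le> norm (apply_bcontfun (x n) i)}"
    proof safe
      fix i assume "e \<le> norm (apply_bcontfun l i)"
      moreover have "norm (apply_bcontfun (x n) i - apply_bcontfun l i) < e/2"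
        using dist_bounded[of "x n" i l] n by (simp add: dist_norm)
      ultimately show "e/2 \<le> norm (apply_bcontfun (x n) i)"
        using norm_triangle_ineq2[of "apply_bcontfun l i" "apply_bcontfun (x n) i"]
        by (simp add: norm_minus_commute)
    qed
    then show "{i. e \<le> norm (apply_bcontfun l i)} \<in> \<I>"
      by (rule ideal_subset[OF assms, rotated], intro c0_idealD) (use x \<open>e > 0\<close> in auto)
  qed
qed

lemma ideal_Fin: "ideal_on_omega (Collect finite)"
  by (auto simp: ideal_on_omega_def intro: finite_subset)

text \<open>Makes closedness and linearity of \<open>c0\<close> instances of the corresponding facts
  about \<open>c0_ideal\<close>.\<close>

lemma c0_eq_c0_ideal_Fin: "c0 = c0_ideal (Collect finite)"
proof -
  have "(\<forall>\<^sub>F n in sequentially. norm (g n) < e) \<longleftrightarrow> finite {n. e \<le> norm (g n)}"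
    for g :: "nat \<Rightarrow> 'a" and e :: real
    by (simp add: cofinite_eq_sequentially[symmetric] eventually_cofinite not_less)
  then show ?thesis by (auto simp: c0_def c0_ideal_def tendsto_iff)
qed

lemma closed_c0: "closed (c0 :: (nat \<Rightarrow>\<^sub>C 'k::real_normed_field) set)"
  unfolding c0_eq_c0_ideal_Fin by (rule closed_c0_ideal[OF ideal_Fin])

lemma unit_seq_in_c0: "unit_seq n \<in> c0"
  unfolding c0_eq_c0_ideal_Fin by (rule c0_ideal_supported[OF ideal_Fin, of "{n}"]) auto

section \<open>Linear structure of the sequence spaces\<close>

context banach_over
begin

lemma norm_scale_seq: "norm (scale_seq scale c x) = norm c * norm x"
proof (rule antisym)
  have le: "norm (scale_seq scale c x) \<le> norm c * norm x" for c x
    by (rule norm_bound) (auto simp: apply_scale_seq norm_scale norm_bounded mult_left_mono)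
  then show "norm (scale_seq scale c x) \<le> norm c * norm x" .
  show "norm c * norm x \<le> norm (scale_seq scale c x)"
  proof (cases "c = 0")
    case False
    then have "x = scale_seq scale (inverse c) (scale_seq scale c x)"
      by (intro bcontfun_eqI) (simp add: apply_scale_seq)
    then have "norm x \<le> norm (inverse c) * norm (scale_seq scale c x)"
      using le by metis
    then have "norm c * norm x \<le> norm c * (norm (inverse c) * norm (scale_seq scale c x))"
      by (rule mult_left_mono) simp
    also have "\<dots> = norm (scale_seq scale c x)"
      using False by (simp add: norm_inverse mult.assoc[symmetric])
    finally show ?thesis .
  qed simp
qed

lemma banach_over_scale_seq: "banach_over (scale_seq scale)"
proof
  fix a b :: 'k and x y :: "nat \<Rightarrow>\<^sub>C 'a"
  show "scale_seq scale a (x + y) = scale_seq scale a x + scale_seq scale a y"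
    by (rule bcontfun_eqI) (simp add: apply_scale_seq scale_right_distrib)
  show "scale_seq scale (a + b) x = scale_seq scale a x + scale_seq scale b x"
    by (rule bcontfun_eqI) (simp add: apply_scale_seq scale_left_distrib)
  show "scale_seq scale a (scale_seq scale b x) = scale_seq scale (a * b) x"
    by (rule bcontfun_eqI) (simp add: apply_scale_seq)
  show "scale_seq scale 1 x = x"
    by (rule bcontfun_eqI) (simp add: apply_scale_seq)
qed (rule norm_scale_seq)

lemma subspace_c0_ideal:
  assumes "ideal_on_omega \<I>"
  shows "module.subspace (scale_seq scale) (c0_ideal \<I>)"
proof -
  interpret S: banach_over "scale_seq scale" by (rule banach_over_scale_seq)
  show ?thesis
  proof (rule S.subspaceI)
    show "0 \<in> c0_ideal \<I>" by (rule c0_ideal_supported[of _ "{}"]) (use assms in \<open>auto simp: ideal_finite\<close>)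
  next
    fix x y :: "nat \<Rightarrow>\<^sub>C 'a" assume xy: "x \<in> c0_ideal \<I>" "y \<in> c0_ideal \<I>"
    show "x + y \<in> c0_ideal \<I>"
    proof (rule c0_idealI)
      fix e :: real assume "e > 0"
      have "{n. e \<le> norm (apply_bcontfun (x + y) n)} \<subseteq>
         {n. e/2 \<le> norm (apply_bcontfun x n)} \<union> {n. e/2 \<le> norm (apply_bcontfun y n)}"
      proof safe
        fix n assume "e \<le> norm (apply_bcontfun (x + y) n)" "\<not> e/2 \<le> norm (apply_bcontfun y n)"
        then show "e/2 \<le> norm (apply_bcontfun x n)"
          using norm_triangle_ineq[of "apply_bcontfun x n" "apply_bcontfun y n"] by simp
      qed
      then show "{n. e \<le> norm (apply_bcontfun (x + y) n)} \<in> \<I>"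
        by (rule ideal_subset[OF assms, rotated], intro ideal_Un[OF assms]) (intro c0_idealD xy half_gt_zero \<open>e > 0\<close>)+
    qed
  next
    fix c and x :: "nat \<Rightarrow>\<^sub>C 'a" assume x: "x \<in> c0_ideal \<I>"
    show "scale_seq scale c x \<in> c0_ideal \<I>"
    proof (rule c0_idealI)
      fix e :: real assume "e > 0"
      \<comment> \<open>The summand 1 keeps the divisor positive when \<open>c = 0\<close>.\<close>
      have pos: "norm c + 1 > 0" using norm_ge_zero[of c] by linarith
      have "{n. e \<le> norm (apply_bcontfun (scale_seq scale c x) n)} \<subseteq>
         {n. e / (norm c + 1) \<le> norm (apply_bcontfun x n)}"
      proof safe
        fix n assume "e \<le> norm (apply_bcontfun (scale_seq scale c x) n)"
        also have "\<dots> \<le> (norm c + 1) * norm (apply_bcontfun x n)"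
          unfolding apply_scale_seq norm_scale by (intro mult_right_mono) auto
        finally show "e / (norm c + 1) \<le> norm (apply_bcontfun x n)"
          using pos by (simp add: divide_le_eq mult.commute)
      qed
      moreover have "e / (norm c + 1) > 0" using \<open>e > 0\<close> pos by simp
      ultimately show "{n. e \<le> norm (apply_bcontfun (scale_seq scale c x) n)} \<in> \<I>"
        using ideal_subset[OF assms c0_idealD[OF x]] by blast
    qed
  qed
qed

end

section \<open>A criterion for complemented copies of \<open>c\<^sub>0\<close>\<close>

text \<open>Weakly unconditionally Cauchy series in quantitative form: \<open>K\<close> bounds the
  operator that sends the unit vectors of \<open>c0\<close> to the \<open>x n\<close>.\<close>

definition wuc :: "('k::real_normed_field \<Rightarrow> 'a \<Rightarrow> 'a) \<Rightarrow> real \<Rightarrow> (nat \<Rightarrow> 'a::real_normed_vector) \<Rightarrow> bool" where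
  "wuc s K x \<longleftrightarrow>
     (\<forall>a F. finite F \<longrightarrow> (\<forall>n\<in>F. norm (a n) \<le> 1) \<longrightarrow> norm (\<Sum>n\<in>F. s (a n) (x n)) \<le> K)"

text \<open>The uniform bound \<open>M\<close> is carried as a parameter; unlike in
  \<open>dual_space\<close>, the values outside \<open>W\<close> are left free.\<close>

definition weak_star_null ::
  "('k::real_normed_field \<Rightarrow> 'a \<Rightarrow> 'a) \<Rightarrow> 'a::real_normed_vector set \<Rightarrow> real \<Rightarrow> (nat \<Rightarrow> 'a \<Rightarrow> 'k) \<Rightarrow> bool" where
  "weak_star_null s W M f \<longleftrightarrow>
     0 \<le> M \<and> (\<forall>n. bounded_linear_on s (*) W (f n)) \<and>
     (\<forall>n. \<forall>x\<in>W. norm (f n x) \<le> M * norm x) \<and> (\<forall>x\<in>W. (\<lambda>n. f n x) \<longlonglongrightarrow> 0)"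

lemma wucD: "wuc s K x \<Longrightarrow> finite F \<Longrightarrow> (\<And>n. n \<in> F \<Longrightarrow> norm (a n) \<le> 1) \<Longrightarrow> norm (\<Sum>n\<in>F. s (a n) (x n)) \<le> K"
  by (auto simp: wuc_def)

lemma wuc_nonneg: "wuc s K x \<Longrightarrow> 0 \<le> K"
  using wucD[of s K x "{}"] by simp

lemma wuc_subseq:
  assumes "wuc s K x" "inj r" shows "wuc s K (\<lambda>k. x (r k))"
  unfolding wuc_def
proof (intro allI impI)
  fix a :: "nat \<Rightarrow> 'a" and F :: "nat set" assume F: "finite F" "\<forall>n\<in>F. norm (a n) \<le> 1"
  have "(\<Sum>n\<in>F. s (a n) (x (r n))) = (\<Sum>n\<in>r ` F. s (a (inv r n)) (x n))"
    using assms(2) by (subst sum.reindex) (auto intro: inj_on_subset)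
  also have "norm \<dots> \<le> K"
    using F assms(2) by (intro wucD[OF assms(1)]) auto
  finally show "norm (\<Sum>n\<in>F. s (a n) (x (r n))) \<le> K" .
qed

lemma weak_star_nullD:
  assumes "weak_star_null s W M f"
  shows "0 \<le> M" "bounded_linear_on s (*) W (f n)" "x \<in> W \<Longrightarrow> norm (f n x) \<le> M * norm x"
    "x \<in> W \<Longrightarrow> (\<lambda>n. f n x) \<longlonglongrightarrow> 0"
  using assms by (auto simp: weak_star_null_def)

lemma weak_star_null_subseq:
  assumes "weak_star_null s W M f" "strict_mono r"
  shows "weak_star_null s W M (\<lambda>k. f (r k))"
  using assms by (auto simp: weak_star_null_def dest: LIMSEQ_subseq_LIMSEQ[unfolded comp_def])

lemma bounded_linear_onD:
  assumes "bounded_linear_on s t W f"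
  shows "x \<in> W \<Longrightarrow> y \<in> W \<Longrightarrow> f (x + y) = f x + f y" "x \<in> W \<Longrightarrow> f (s c x) = t c (f x)"
  using assms by (auto simp: bounded_linear_on_def)

lemma bounded_linear_onI:
  assumes "\<And>x y. x \<in> W \<Longrightarrow> y \<in> W \<Longrightarrow> f (x + y) = f x + f y" "\<And>c x. x \<in> W \<Longrightarrow> f (s c x) = t c (f x)"
    "\<And>x. x \<in> W \<Longrightarrow> norm (f x) \<le> K * norm x"
  shows "bounded_linear_on s t W f"
  unfolding bounded_linear_on_def using assms by blast

lemma bounded_linear_on_bound:
  assumes "bounded_linear_on s t W f"
  obtains K where "0 \<le> K" "\<And>x. x \<in> W \<Longrightarrow> norm (f x) \<le> K * norm x"
proof -
  obtain K where K: "\<And>x. x \<in> W \<Longrightarrow> norm (f x) \<le> K * norm x"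
    using assms unfolding bounded_linear_on_def by blast
  have "norm (f x) \<le> \<bar>K\<bar> * norm x" if "x \<in> W" for x
    using K[OF that] by (meson abs_ge_self mult_right_mono norm_ge_zero order_trans)
  then show ?thesis using that[of "\<bar>K\<bar>"] by simp
qed

text \<open>For nonzero \<open>z\<close>, the factor of modulus one that turns \<open>z\<close> into
  its modulus, a substitute for the conjugate sign in an abstract field; at \<open>z = 0\<close> it
  is 0.\<close>

definition unit_conj :: "'k::real_normed_field \<Rightarrow> 'k" where
  "unit_conj z = of_real (norm z) / z"

lemma unit_conj_mult: "unit_conj z * z = of_real (norm z)"
  by (cases "z = 0") (auto simp: unit_conj_def)

lemma norm_unit_conj_le: "norm (unit_conj z) \<le> 1"
  by (cases "z = 0") (auto simp: unit_conj_def norm_divide)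

section \<open>Series and functionals on subspaces\<close>

context banach_over
begin

lemma tendsto_scale:
  assumes "(X \<longlongrightarrow> L) F" shows "((\<lambda>n. scale c (X n)) \<longlongrightarrow> scale c L) F"
proof -
  have "((\<lambda>n. norm (scale c (X n) - scale c L)) \<longlongrightarrow> norm c * 0) F"
    unfolding scale_right_diff_distrib[symmetric] norm_scale
    using assms by (intro tendsto_intros tendsto_norm_zero) (simp add: LIM_zero)
  then show ?thesis by (simp add: tendsto_norm_zero_iff LIM_zero_cancel)
qed

lemma bounded_linear_on_zero:
  assumes "banach_over t" "bounded_linear_on scale t W f" "0 \<in> W"
  shows "f 0 = 0"
proof -
  interpret t: banach_over t by fact
  show ?thesis using bounded_linear_onD(2)[OF assms(2,3), of 0] by simp
qed

lemma bounded_linear_on_combination: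
  assumes "banach_over t" "bounded_linear_on scale t W f" "subspace W" "finite F" "\<And>n. n \<in> F \<Longrightarrow> x n \<in> W"
  shows "f (\<Sum>n\<in>F. scale (a n) (x n)) = (\<Sum>n\<in>F. t (a n) (f (x n)))"
  using assms(4,5)
proof (induct F rule: finite_induct)
  case empty
  then show ?case using bounded_linear_on_zero[OF assms(1,2)] subspace_0[OF assms(3)] by simp
next
  case (insert i F)
  then have "(\<Sum>n\<in>F. scale (a n) (x n)) \<in> W"
    using assms(3) by (intro subspace_sum subspace_scale) auto
  then show ?case
    using insert assms(3) by (simp add: bounded_linear_onD[OF assms(2)] subspace_scale)
qed

lemma bounded_linear_on_diff:
  assumes "banach_over t" "bounded_linear_on scale t W f" "subspace W" "x \<in> W" "y \<in> W"
  shows "f (x - y) = f x - f y"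
proof -
  have "f ((x - y) + y) = f (x - y) + f y"
    using assms by (intro bounded_linear_onD[OF assms(2)]) (auto simp: subspace_diff)
  then show ?thesis by simp
qed

lemma norm_combination_le:
  assumes "wuc scale K x" "finite F" "0 \<le> c" "\<And>n. n \<in> F \<Longrightarrow> norm (a n) \<le> c"
  shows "norm (\<Sum>n\<in>F. scale (a n) (x n)) \<le> c * K"
proof (cases "c = 0")
  case False
  have "norm (\<Sum>n\<in>F. scale (a n / of_real c) (x n)) \<le> K"
    using assms False by (intro wucD[OF assms(1,2)]) (auto simp: norm_divide divide_le_eq_1)
  moreover have "(\<Sum>n\<in>F. scale (a n) (x n)) = scale (of_real c) (\<Sum>n\<in>F. scale (a n / of_real c) (x n))"
    using False by (simp add: scale_sum_right)
  ultimately show ?thesis using \<open>0 \<le> c\<close> by (simp add: norm_scale mult_left_mono)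
qed (use assms in simp)

text \<open>Rotating every \<open>h (x n)\<close> onto its modulus by the coefficients
  \<open>unit_conj\<close> turns the sum of the moduli into one value of \<open>h\<close>, at a
  vector of norm at most \<open>K\<close>.\<close>

lemma sum_norm_functional_le:
  assumes "wuc scale K x" "subspace W" "\<And>n. x n \<in> W" "finite F"
    and h: "bounded_linear_on scale (*) W h" "\<And>w. w \<in> W \<Longrightarrow> norm (h w) \<le> M * norm w" "0 \<le> M"
  shows "(\<Sum>n\<in>F. norm (h (x n))) \<le> M * K"
proof -
  let ?v = "\<Sum>n\<in>F. scale (unit_conj (h (x n))) (x n)"
  have v: "?v \<in> W" using assms(2,3) by (intro subspace_sum subspace_scale) auto
  have "h ?v = (\<Sum>n\<in>F. unit_conj (h (x n)) * h (x n))"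
    using assms by (intro bounded_linear_on_combination banach_over_mult) auto
  also have "\<dots> = of_real (\<Sum>n\<in>F. norm (h (x n)))"
    by (simp add: unit_conj_mult)
  finally have "(\<Sum>n\<in>F. norm (h (x n))) = norm (h ?v)"
    by (simp add: sum_nonneg del: of_real_sum)
  also have "\<dots> \<le> M * norm ?v" using h(2) v by blast
  also have "\<dots> \<le> M * K"
    using assms(4) h(3) by (intro mult_left_mono wucD[OF assms(1)] norm_unit_conj_le)
  finally show ?thesis .
qed

lemma summable_functional:
  assumes "wuc scale K x" "subspace W" "\<And>n. x n \<in> W"
    and h: "bounded_linear_on scale (*) W h" "\<And>w. w \<in> W \<Longrightarrow> norm (h w) \<le> M * norm w" "0 \<le> M"
  shows "summable (\<lambda>n. norm (h (x n)))" "(\<lambda>n. h (x n)) \<longlonglongrightarrow> 0"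
proof -
  show s: "summable (\<lambda>n. norm (h (x n)))"
    by (rule summableI_nonneg_bounded[where x = "M * K"])
      (use sum_norm_functional_le[OF assms(1-3) _ h] in auto)
  show "(\<lambda>n. h (x n)) \<longlonglongrightarrow> 0"
    using summable_LIMSEQ_zero[OF s] by (rule tendsto_norm_zero_cancel)
qed

text \<open>Far out the coefficients are uniformly small, and finite sums of a \<open>wuc\<close>
  series are bounded by \<open>K\<close> times the largest coefficient, so the partial sums are
  Cauchy; closedness keeps the limit in \<open>W\<close>.\<close>

lemma c0_series:
  assumes x: "wuc scale K x" and W: "subspace W" "closed W" "\<And>n. x n \<in> W" and a: "a \<in> c0"
  shows "summable (\<lambda>n. scale (apply_bcontfun a n) (x n))"
    and "(\<Sum>n. scale (apply_bcontfun a n) (x n)) \<in> W"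
    and "norm (\<Sum>n. scale (apply_bcontfun a n) (x n)) \<le> K * norm a"
proof -
  let ?f = "\<lambda>n. scale (apply_bcontfun a n) (x n)"
  show s: "summable ?f"
    unfolding summable_Cauchy
  proof (intro allI impI)
    fix e :: real assume "e > 0"
    have K: "0 \<le> K" using wuc_nonneg[OF x] .
    \<comment> \<open>Dividing by \<open>K + 1\<close> rather than \<open>K\<close> covers
      \<open>K = 0\<close> and makes the final estimate strict.\<close>
    let ?d = "e / (K + 1)"
    have "?d > 0" using \<open>e > 0\<close> K by simp
    then obtain N where N: "\<And>n. n \<ge> N \<Longrightarrow> norm (apply_bcontfun a n) < ?d"
      using a unfolding c0_def tendsto_iff eventually_sequentially by auto
    have "norm (sum ?f {m..<n}) < e" if "m \<ge> N" for m n
    proof -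
      have "norm (sum ?f {m..<n}) \<le> ?d * K"
        using N that \<open>?d > 0\<close> by (intro norm_combination_le[OF x]) (auto intro: less_imp_le)
      also have "\<dots> < e" using K \<open>e > 0\<close> by (simp add: divide_less_eq)
      finally show ?thesis .
    qed
    then show "\<exists>N. \<forall>m\<ge>N. \<forall>n. norm (sum ?f {m..<n}) < e" by blast
  qed
  then have lim: "(\<lambda>n. \<Sum>i<n. ?f i) \<longlonglongrightarrow> (\<Sum>n. ?f n)"
    by (rule summable_LIMSEQ)
  have "(\<Sum>i<n. ?f i) \<in> W" for n
    using W by (intro subspace_sum subspace_scale)
  then show "(\<Sum>n. ?f n) \<in> W"
    using closed_sequentially[OF W(2) _ lim] by blast
  have "norm (\<Sum>i<n. ?f i) \<le> K * norm a" for n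
    using norm_combination_le[OF x, of "{..<n}" "norm a" "apply_bcontfun a"]
    by (simp add: norm_bounded mult.commute)
  then show "norm (\<Sum>n. ?f n) \<le> K * norm a"
    by (intro Lim_norm_ubound[OF _ lim]) auto
qed

lemma functional_tendsto:
  assumes W: "subspace W" "X \<longlonglongrightarrow> l" "\<And>n. X n \<in> W" "l \<in> W"
    and h: "bounded_linear_on scale (*) W h" "\<And>w. w \<in> W \<Longrightarrow> norm (h w) \<le> M * norm w"
  shows "(\<lambda>n. h (X n)) \<longlonglongrightarrow> h l"
proof -
  have "(\<lambda>n. M * norm (X n - l)) \<longlonglongrightarrow> M * 0"
    using W(2) by (intro tendsto_intros tendsto_norm_zero) (simp add: LIM_zero)
  moreover have "norm (h (X n) - h l) \<le> M * norm (X n - l)" for n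
    using h(2)[of "X n - l"] W
    by (simp add: subspace_diff bounded_linear_on_diff[OF banach_over_mult h(1) W(1)])
  ultimately have "(\<lambda>n. h (X n) - h l) \<longlonglongrightarrow> 0"
    by (intro Lim_null_comparison[of "\<lambda>n. h (X n) - h l"]) auto
  then show ?thesis by (rule LIM_zero_cancel)
qed

end

section \<open>The criterion in both directions\<close>

context banach_over
begin

text \<open>\<open>T\<close> sums the series with coefficients from \<open>c0\<close>, and
  \<open>S\<close> collects the values of the \<open>f n\<close>. The matrix of \<open>S\<close>
  after \<open>T\<close> has diagonal 1 and rows otherwise at most 1/2 in sum, so \<open>S\<close>
  after \<open>T\<close> is within 1/2 of the identity and has an inverse \<open>G\<close>. Then
  \<open>P\<close>, that is \<open>T\<close> after \<open>G\<close> after \<open>S\<close>, projects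
  onto the range of \<open>T\<close>.\<close>

lemma complemented_c0_of_almost_biorthogonal:
  assumes W: "subspace W" "closed W" and x: "wuc scale K x" "\<And>n. x n \<in> W"
    and f: "weak_star_null scale W M f" and diag: "\<And>n. f n (x n) = 1"
    and off: "\<And>n F. finite F \<Longrightarrow> n \<notin> F \<Longrightarrow> (\<Sum>m\<in>F. norm (f n (x m))) \<le> 1/2"
  shows "complemented_copy (scale_seq (*)) (c0 :: (nat \<Rightarrow>\<^sub>C 'k) set) scale W"
proof -
  let ?sc = "scale_seq (*) :: 'k \<Rightarrow> (nat \<Rightarrow>\<^sub>C 'k) \<Rightarrow> (nat \<Rightarrow>\<^sub>C 'k)"
  let ?c0 = "c0 :: (nat \<Rightarrow>\<^sub>C 'k) set"
  interpret k: banach_over "(*) :: 'k \<Rightarrow> 'k \<Rightarrow> 'k" by (rule banach_over_mult)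
  interpret C: banach_over ?sc by (rule k.banach_over_scale_seq)
  have sub: "C.subspace ?c0"
    unfolding c0_eq_c0_ideal_Fin by (rule k.subspace_c0_ideal[OF ideal_Fin])
  note f_lin = bounded_linear_onD[OF weak_star_nullD(2)[OF f]]
  note f_bound = weak_star_nullD(3)[OF f]
  have K: "0 \<le> K" by (rule wuc_nonneg[OF x(1)])
  have M: "0 \<le> M" by (rule weak_star_nullD(1)[OF f])

  define T where "T a = (\<Sum>n. scale (apply_bcontfun a n) (x n))" for a
  note series = c0_series[OF x(1) W x(2)]
  have T_W: "T a \<in> W" and T_bound: "norm (T a) \<le> K * norm a" if "a \<in> c0" for a
    using series[OF that] by (simp_all add: T_def)
  have T_add: "T (a + b) = T a + T b" if "a \<in> c0" "b \<in> c0" for a b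
    using suminf_add[OF series(1)[OF that(1)] series(1)[OF that(2)]]
    by (simp add: T_def scale_left_distrib)
  have T_scale: "T (?sc c a) = scale c (T a)" if "a \<in> c0" for c a
  proof -
    have "(\<lambda>n. scale c (\<Sum>i<n. scale (apply_bcontfun a i) (x i))) \<longlonglongrightarrow> scale c (T a)"
      unfolding T_def by (intro tendsto_scale summable_LIMSEQ series(1) that)
    then have "(\<lambda>i. scale (apply_bcontfun (?sc c a) i) (x i)) sums scale c (T a)"
      by (simp add: sums_def scale_sum_right k.apply_scale_seq)
    then show ?thesis unfolding T_def by (rule sums_unique[symmetric])
  qed

  define S where "S w = (Bcontfun (\<lambda>n. f n w) :: nat \<Rightarrow>\<^sub>C 'k)" for w
  have S_apply: "apply_bcontfun (S w) n = f n w" if "w \<in> W" for w n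
    unfolding S_def by (subst apply_Bcontfun[OF f_bound[OF that]]) simp
  have S_c0: "S w \<in> c0" if "w \<in> W" for w
  proof -
    have "apply_bcontfun (S w) = (\<lambda>n. f n w)" using S_apply[OF that] by (rule ext)
    then show ?thesis using weak_star_nullD(4)[OF f that] by (simp add: c0_def)
  qed
  have S_bound: "norm (S w) \<le> M * norm w" if "w \<in> W" for w
    by (rule norm_bound) (simp add: S_apply that f_bound)
  have S_add: "S (v + w) = S v + S w" if "v \<in> W" "w \<in> W" for v w
    by (rule bcontfun_eqI) (simp add: S_apply that subspace_add W f_lin)
  have S_scale: "S (scale c w) = ?sc c (S w)" if "w \<in> W" for c w
    by (rule bcontfun_eqI) (simp add: S_apply that subspace_scale W f_lin k.apply_scale_seq)

  \<comment> \<open>The deviation of \<open>S\<close> after \<open>T\<close> from the identity; by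
    \<open>off\<close> it contracts with factor 1/2.\<close>
  define B where "B a = a - S (T a)" for a
  have B_c0: "B a \<in> c0" if "a \<in> c0" for a
    unfolding B_def using that by (intro C.subspace_diff[OF sub] S_c0 T_W)
  have B_diff: "B a - B b = B (a - b)" if "a \<in> c0" "b \<in> c0" for a b
  proof -
    have "a - b \<in> c0" using that C.subspace_diff[OF sub] by blast
    then have "S (T ((a - b) + b)) = S (T (a - b)) + S (T b)"
      using that by (simp only: T_add S_add T_W)
    then show ?thesis by (simp add: B_def)
  qed
  have B_bound: "norm (B a) \<le> 1/2 * norm a" if a: "a \<in> c0" for a
  proof (rule norm_bound)
    fix n
    let ?s = "\<lambda>N. \<Sum>i<N. scale (apply_bcontfun a i) (x i)"
    have s_W: "?s N \<in> W" for N using W(1) x(2) by (intro subspace_sum subspace_scale)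
    have "?s \<longlonglongrightarrow> T a" unfolding T_def by (intro summable_LIMSEQ series(1) a)
    then have "(\<lambda>N. f n (?s N)) \<longlonglongrightarrow> f n (T a)"
      by (rule functional_tendsto[OF W(1) _ s_W T_W[OF a] weak_star_nullD(2)[OF f] f_bound])
    then have lim: "(\<lambda>N. apply_bcontfun a n - f n (?s N)) \<longlonglongrightarrow> apply_bcontfun a n - f n (T a)"
      by (intro tendsto_intros)
    have "norm (apply_bcontfun a n - f n (?s N)) \<le> 1/2 * norm a" if "N > n" for N
    proof -
      have "f n (?s N) = (\<Sum>i<N. apply_bcontfun a i * f n (x i))"
        using W(1) x(2)
        by (intro bounded_linear_on_combination[OF banach_over_mult weak_star_nullD(2)[OF f]]) auto
      \<comment> \<open>The term \<open>i = n\<close> reproduces \<open>apply_bcontfun a n\<close>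
        because the diagonal is 1; this is where \<open>N > n\<close> enters.\<close>
      also have "\<dots> = apply_bcontfun a n + (\<Sum>i\<in>{..<N} - {n}. apply_bcontfun a i * f n (x i))"
        using that by (subst sum.remove[of _ n]) (auto simp: diag)
      finally have "norm (apply_bcontfun a n - f n (?s N)) =
          norm (\<Sum>i\<in>{..<N} - {n}. apply_bcontfun a i * f n (x i))" by simp
      also have "\<dots> \<le> (\<Sum>i\<in>{..<N} - {n}. norm a * norm (f n (x i)))"
        by (intro sum_norm_le) (simp add: norm_mult mult_right_mono norm_bounded)
      also have "\<dots> = norm a * (\<Sum>i\<in>{..<N} - {n}. norm (f n (x i)))"
        by (rule sum_distrib_left[symmetric])
      also have "\<dots> \<le> norm a * (1/2)"
        by (intro mult_left_mono off) auto
      finally show ?thesis by simp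
    qed
    then have "norm (apply_bcontfun a n - f n (T a)) \<le> 1/2 * norm a"
      by (intro Lim_norm_ubound[OF _ lim]) (auto intro: eventually_mono[OF eventually_gt_at_top])
    then show "norm (apply_bcontfun (B a) n) \<le> 1/2 * norm a"
      by (simp add: B_def S_apply T_W a)
  qed

  have ST_ex1: "\<exists>!a. a \<in> c0 \<and> S (T a) = y" if y: "y \<in> c0" for y
  proof -
    \<comment> \<open>\<open>S (T a) = y\<close> is the fixed point equation of a contraction on the
      complete set \<open>c0\<close>.\<close>
    have "\<exists>!a. a \<in> c0 \<and> y + B a = a"
    proof (rule Banach_fix[where c = "1/2"])
      show "complete ?c0" by (rule closed_c0[THEN complete_eq_closed[THEN iffD2]])
      show "?c0 \<noteq> {}" using y by blast
      show "(\<lambda>a. y + B a) ` ?c0 \<subseteq> ?c0" using y B_c0 C.subspace_add[OF sub] by blast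
      fix a b assume "a \<in> ?c0" "b \<in> ?c0"
      then show "dist (y + B a) (y + B b) \<le> 1/2 * dist a b"
        using B_bound[of "a - b"] by (simp add: dist_norm B_diff C.subspace_diff[OF sub])
    qed auto
    moreover have "y + B a = a \<longleftrightarrow> S (T a) = y" for a by (auto simp: B_def algebra_simps)
    ultimately show ?thesis by simp
  qed
  define G where "G y = (THE a. a \<in> c0 \<and> S (T a) = y)" for y
  have G_c0: "G y \<in> c0" and STG: "S (T (G y)) = y" if "y \<in> c0" for y
    using theI'[OF ST_ex1[OF that]] by (auto simp: G_def)
  have GST: "G (S (T a)) = a" if "a \<in> c0" for a
    unfolding G_def using that ST_ex1[OF S_c0[OF T_W[OF that]]] by (intro the1_equality) auto
  \<comment> \<open>\<open>G\<close> inherits additivity from \<open>S\<close> after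
    \<open>T\<close>, since it undoes that map.\<close>
  have G_add: "G (y + z) = G y + G z" if "y \<in> c0" "z \<in> c0" for y z
  proof -
    have "y + z = S (T (G y + G z))"
      using that by (simp add: T_add S_add T_W G_c0 STG)
    then show ?thesis using that GST C.subspace_add[OF sub] G_c0 by metis
  qed
  have G_scale: "G (?sc c y) = ?sc c (G y)" if "y \<in> c0" for c y
  proof -
    have "?sc c y = S (T (?sc c (G y)))"
      using that by (simp add: T_scale S_scale T_W G_c0 STG)
    then show ?thesis using that GST C.subspace_scale[OF sub] G_c0 by metis
  qed
  \<comment> \<open>\<open>a\<close> is the sum of \<open>B a\<close> and \<open>S (T a)\<close>,
    and \<open>B a\<close> accounts for at most half of its norm.\<close>
  have T_below: "norm a \<le> 2 * M * norm (T a)" if "a \<in> c0" for a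
  proof -
    have "norm a \<le> norm (B a) + norm (S (T a))"
      using norm_triangle_ineq[of "B a" "S (T a)"] by (simp add: B_def)
    then have "norm a \<le> 2 * norm (S (T a))" using B_bound[OF that] by simp
    also have "\<dots> \<le> 2 * (M * norm (T a))" using S_bound[OF T_W[OF that]] by simp
    finally show ?thesis by simp
  qed
  have T_inj: "inj_on T c0" by (rule inj_on_inverseI[of _ "\<lambda>w. G (S w)"]) (rule GST)

  define P where "P w = T (G (S w))" for w
  have "bounded_linear_on scale scale W P"
  proof (rule bounded_linear_onI)
    fix w assume w: "w \<in> W"
    have "norm (P w) \<le> K * norm (G (S w))"
      unfolding P_def by (intro T_bound G_c0 S_c0 w)
    also have "norm (G (S w)) \<le> 2 * norm (S w)"
      using norm_triangle_ineq[of "B (G (S w))" "S (T (G (S w)))"] B_bound[of "G (S w)"]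
        G_c0[OF S_c0[OF w]] STG[OF S_c0[OF w]] by (simp add: B_def)
    then have "K * norm (G (S w)) \<le> K * (2 * (M * norm w))"
      using S_bound[OF w] K by (intro mult_left_mono) auto
    finally show "norm (P w) \<le> (2 * K * M) * norm w" by (simp add: mult_ac)
  qed (simp_all add: P_def S_add S_scale G_add G_scale T_add T_scale S_c0 G_c0)
  moreover have "P ` W = T ` c0"
  proof
    show "P ` W \<subseteq> T ` c0" using G_c0 S_c0 by (auto simp: P_def)
    show "T ` c0 \<subseteq> P ` W"
    proof
      fix w assume "w \<in> T ` c0"
      then obtain a where "a \<in> c0" "w = T a" by blast
      then have "w = P (T a)" "T a \<in> W" by (simp_all add: P_def GST T_W)
      then show "w \<in> P ` W" by blast
    qed
  qed
  moreover have "P (P w) = P w" if "w \<in> W" for w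
    using that by (simp add: P_def GST G_c0 S_c0)
  ultimately have compl: "complemented_subspace scale (T ` c0) W"
    unfolding complemented_subspace_def using T_W by blast

  have "banach_isomorphism ?sc scale c0 (T ` c0) T"
    unfolding banach_isomorphism_def
  proof (intro conjI)
    show "bij_betw T c0 (T ` c0)" using T_inj by (simp add: bij_betw_def)
    show "bounded_linear_on ?sc scale c0 T"
      by (rule bounded_linear_onI[where K = K]) (simp_all add: T_add T_scale T_bound)
    have inv: "inv_into c0 T (T a) = a" if "a \<in> c0" for a
      using T_inj that by (rule inv_into_f_f)
    show "bounded_linear_on scale ?sc (T ` c0) (inv_into c0 T)"
    proof (rule bounded_linear_onI)
      fix v w assume "v \<in> T ` c0" "w \<in> T ` c0"
      then obtain a b where "a \<in> c0" "v = T a" "b \<in> c0" "w = T b" by blast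
      then show "inv_into c0 T (v + w) = inv_into c0 T v + inv_into c0 T w"
        by (simp add: inv C.subspace_add[OF sub] flip: T_add)
    next
      fix c w assume "w \<in> T ` c0"
      then show "inv_into c0 T (scale c w) = ?sc c (inv_into c0 T w)"
        by (auto simp: inv C.subspace_scale[OF sub] simp flip: T_scale)
    next
      fix w assume "w \<in> T ` c0"
      then show "norm (inv_into c0 T w) \<le> (2 * M) * norm w"
        using T_below by (auto simp: inv)
    qed
  qed
  then show ?thesis using compl unfolding complemented_copy_def by blast
qed

text \<open>The rows of the matrix \<open>f i (x n)\<close> tend to zero because the series is
  \<open>wuc\<close>, the columns because the functionals are weak* null. Along a subsequence with
  diagonal at least \<delta> in modulus and off-diagonal row sums at most \<delta>/2, dividing the
  functionals by the diagonal entries gives the almost biorthogonal case.\<close>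

lemma complemented_c0I:
  assumes W: "subspace W" "closed W" and x: "wuc scale K x" "\<And>n. x n \<in> W"
    and f: "weak_star_null scale W M f" and diag: "\<not> (\<lambda>n. f n (x n)) \<longlonglongrightarrow> 0"
  shows "complemented_copy (scale_seq (*)) (c0 :: (nat \<Rightarrow>\<^sub>C 'k) set) scale W"
proof -
  obtain \<delta> where \<delta>: "\<delta> > 0" "\<exists>\<^sub>F n in sequentially. \<delta> \<le> norm (f n (x n))"
    using not_tendsto_zeroE[OF diag] by blast
  have rows: "(\<lambda>n. f i (x n)) \<longlonglongrightarrow> 0" for i
    using summable_functional(2)[OF x(1) W(1) x(2) weak_star_nullD(2,3,1)[OF f]] by blast
  have cols: "(\<lambda>n. f n (x i)) \<longlonglongrightarrow> 0" for i
    using weak_star_nullD(4)[OF f x(2)] .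
  have "\<delta>/2 > 0" using \<delta>(1) by simp
  from small_off_diagonal_subsequence[where a = "\<lambda>i n. f i (x n)", OF rows cols \<delta>(2) this]
  obtain r :: "nat \<Rightarrow> nat" where r: "strict_mono r" "\<And>k. \<delta> \<le> norm (f (r k) (x (r k)))"
    "\<And>j F. finite F \<Longrightarrow> j \<notin> F \<Longrightarrow> (\<Sum>m\<in>F. norm (f (r j) (x (r m)))) \<le> \<delta>/2" by blast
  \<comment> \<open>Division by \<open>d k\<close> enlarges norms by at most the factor
    \<open>1 / \<delta>\<close>, so the bound \<delta>/2 becomes 1/2.\<close>
  define d where "d k = f (r k) (x (r k))" for k
  have d: "norm (z / d k) \<le> norm z / \<delta>" for z k
    using r(2)[of k] \<delta>(1) by (auto simp: d_def norm_divide intro!: frac_le)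
  note fr = weak_star_null_subseq[OF f r(1)]
  show ?thesis
  proof (rule complemented_c0_of_almost_biorthogonal[OF W])
    show "wuc scale K (\<lambda>k. x (r k))"
      using x(1) strict_mono_imp_inj_on[OF r(1)] by (rule wuc_subseq)
    show "weak_star_null scale W (M / \<delta>) (\<lambda>k w. f (r k) w / d k)"
      unfolding weak_star_null_def
    proof (intro conjI allI ballI)
      show "0 \<le> M / \<delta>" using weak_star_nullD(1)[OF f] \<delta>(1) by simp
      show bound: "norm (f (r k) w / d k) \<le> M / \<delta> * norm w" if "w \<in> W" for k w
        using order_trans[OF d divide_right_mono[OF weak_star_nullD(3)[OF f that]]] \<delta>(1) by simp
      show "bounded_linear_on scale (*) W (\<lambda>w. f (r k) w / d k)" for k
        by (rule bounded_linear_onI[OF _ _ bound])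
          (simp_all add: bounded_linear_onD[OF weak_star_nullD(2)[OF f]] add_divide_distrib)
      fix w assume w: "w \<in> W"
      show "(\<lambda>k. f (r k) w / d k) \<longlonglongrightarrow> 0"
      proof (rule Lim_null_comparison)
        show "\<forall>\<^sub>F k in sequentially. norm (f (r k) w / d k) \<le> norm (f (r k) w) / \<delta>"
          using d by simp
        show "(\<lambda>k. norm (f (r k) w) / \<delta>) \<longlonglongrightarrow> 0"
          using weak_star_nullD(4)[OF fr w] by (intro tendsto_divide_zero tendsto_norm_zero)
      qed
    qed
    show "f (r k) (x (r k)) / d k = 1" for k
      using r(2)[of k] \<delta>(1) by (auto simp: d_def)
    show "(\<Sum>m\<in>F. norm (f (r k) (x (r m)) / d k)) \<le> 1/2" if "finite F" "k \<notin> F" for k F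
    proof -
      have "(\<Sum>m\<in>F. norm (f (r k) (x (r m)) / d k)) \<le> (\<Sum>m\<in>F. norm (f (r k) (x (r m))) / \<delta>)"
        by (intro sum_mono d)
      also have "\<dots> = (\<Sum>m\<in>F. norm (f (r k) (x (r m)))) / \<delta>" by (simp add: sum_divide_distrib)
      also have "\<dots> \<le> (\<delta>/2) / \<delta>" using r(3)[OF that] \<delta>(1) by (intro divide_right_mono) auto
      finally show ?thesis using \<delta>(1) by simp
    qed
  qed (use x(2) in auto)
qed

text \<open>\<open>x\<close> consists of the images of the unit vectors, and \<open>f n\<close>
  reads off the \<open>n\<close>-th coordinate after projecting onto the copy and going back to
  \<open>c0\<close>.\<close>

lemma complemented_c0D:
  assumes W: "subspace W" and "complemented_copy (scale_seq (*)) (c0 :: (nat \<Rightarrow>\<^sub>C 'k) set) scale W"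
  shows "\<exists>K x M f. wuc scale K x \<and> (\<forall>n. x n \<in> W) \<and> weak_star_null scale W M f \<and>
    (\<forall>m n. f m (x n) = (if m = n then 1 else 0))"
proof -
  let ?sc = "scale_seq (*) :: 'k \<Rightarrow> (nat \<Rightarrow>\<^sub>C 'k) \<Rightarrow> (nat \<Rightarrow>\<^sub>C 'k)"
  interpret k: banach_over "(*) :: 'k \<Rightarrow> 'k \<Rightarrow> 'k" by (rule banach_over_mult)
  interpret C: banach_over ?sc by (rule k.banach_over_scale_seq)
  have sub: "C.subspace (c0 :: (nat \<Rightarrow>\<^sub>C 'k) set)"
    unfolding c0_eq_c0_ideal_Fin by (rule k.subspace_c0_ideal[OF ideal_Fin])
  obtain Y T P where Y: "Y \<subseteq> W" and P: "bounded_linear_on scale scale W P" "P ` W = Y" "\<And>w. w \<in> W \<Longrightarrow> P (P w) = P w"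
    and T: "bij_betw T c0 Y" "bounded_linear_on ?sc scale c0 T"
    and R: "bounded_linear_on scale ?sc Y (inv_into c0 T)"
    using assms(2) unfolding complemented_copy_def complemented_subspace_def banach_isomorphism_def
    by blast
  obtain KT where KT: "0 \<le> KT" "\<And>a. a \<in> c0 \<Longrightarrow> norm (T a) \<le> KT * norm a"
    using bounded_linear_on_bound[OF T(2)] by blast
  obtain KP where KP: "0 \<le> KP" "\<And>w. w \<in> W \<Longrightarrow> norm (P w) \<le> KP * norm w"
    using bounded_linear_on_bound[OF P(1)] by blast
  obtain KR where KR: "0 \<le> KR" "\<And>w. w \<in> Y \<Longrightarrow> norm (inv_into c0 T w) \<le> KR * norm w"
    using bounded_linear_on_bound[OF R] by blast
  have P_Y: "P w \<in> Y" if "w \<in> W" for w using that P(2) by blast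
  have PY: "P w = w" if "w \<in> Y" for w using that P(2,3) by auto
  have T_Y: "T a \<in> Y" if "a \<in> c0" for a using T(1) that by (auto simp: bij_betw_def)
  have R_c0: "inv_into c0 T w \<in> c0" if "w \<in> Y" for w
    using T(1) that by (metis bij_betw_def inv_into_into)
  have RT: "inv_into c0 T (T a) = a" if "a \<in> c0" for a
    using T(1) that by (simp add: bij_betw_def inv_into_f_f)
  define x where "x n = T (unit_seq n)" for n
  define f where "f n w = apply_bcontfun (inv_into c0 T (P w)) n" for n w
  show ?thesis
  proof (intro exI conjI allI)
    show "wuc scale KT x"
      unfolding wuc_def
    proof (intro allI impI)
      fix a :: "nat \<Rightarrow> 'k" and F :: "nat set" assume F: "finite F" "\<forall>n\<in>F. norm (a n) \<le> 1"
      let ?v = "\<Sum>n\<in>F. ?sc (a n) (unit_seq n)"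
      have v: "?v \<in> c0" by (intro C.subspace_sum[OF sub] C.subspace_scale[OF sub] unit_seq_in_c0)
      have "norm ?v \<le> 1"
      proof (rule norm_bound)
        fix i
        have "apply_bcontfun ?v i = (\<Sum>n\<in>F. if n = i then a n else 0)"
          unfolding apply_bcontfun_sum by (intro sum.cong) (auto simp: k.apply_scale_seq)
        then show "norm (apply_bcontfun ?v i) \<le> 1" using F by auto
      qed
      then have "norm (T ?v) \<le> KT"
        using KT(2)[OF v] mult_left_mono[OF _ KT(1), of "norm ?v" 1] by simp
      moreover have "T ?v = (\<Sum>n\<in>F. scale (a n) (x n))"
        unfolding x_def
        by (rule C.bounded_linear_on_combination[OF banach_over_axioms T(2) sub F(1) unit_seq_in_c0])
      ultimately show "norm (\<Sum>n\<in>F. scale (a n) (x n)) \<le> KT" by simp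
    qed
    show "x n \<in> W" for n using Y T_Y unit_seq_in_c0 by (auto simp: x_def)
    show "f m (x n) = (if m = n then 1 else 0)" for m n
      by (simp add: f_def x_def PY T_Y RT unit_seq_in_c0)
    show "weak_star_null scale W (KR * KP) f"
      unfolding weak_star_null_def
    proof (intro conjI allI ballI)
      show "0 \<le> KR * KP" using KR KP by simp
      show bound: "norm (f n w) \<le> KR * KP * norm w" if "w \<in> W" for n w
      proof -
        have "norm (f n w) \<le> KR * norm (P w)"
          unfolding f_def using KR(2)[OF P_Y[OF that]] norm_bounded order_trans by blast
        also have "\<dots> \<le> KR * (KP * norm w)" using KP(2)[OF that] KR(1) by (rule mult_left_mono)
        finally show ?thesis by (simp add: mult.assoc)
      qed
      show "bounded_linear_on scale (*) W (f n)" for n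
        by (rule bounded_linear_onI[OF _ _ bound])
          (simp_all add: f_def bounded_linear_onD[OF P(1)] bounded_linear_onD[OF R] P_Y k.apply_scale_seq)
      show "(\<lambda>n. f n w) \<longlonglongrightarrow> 0" if "w \<in> W" for w
        using R_c0[OF P_Y[OF that]] by (simp add: f_def c0_def)
    qed
  qed
qed

end

section \<open>Phillips' lemma\<close>

text \<open>The branches of the binary tree form an uncountable almost disjoint family.\<close>

definition branch :: "nat set \<Rightarrow> nat set" where
  "branch S = range (\<lambda>n. to_nat (map (\<lambda>i. i \<in> S) [0..<n]))"

lemma inj_branch_code: "inj (\<lambda>n. to_nat (map (\<lambda>i. i \<in> S) [0..<n]))"
proof (rule injI)
  fix m n assume "to_nat (map (\<lambda>i. i \<in> S) [0..<m]) = to_nat (map (\<lambda>i. i \<in> S) [0..<n])"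
  then have "map (\<lambda>i. i \<in> S) [0..<m] = map (\<lambda>i. i \<in> S) [0..<n]" by simp
  from arg_cong[OF this, of length] show "m = n" by simp
qed

lemma infinite_branch: "infinite (branch S)"
  unfolding branch_def using inj_branch_code by (rule range_inj_infinite)

text \<open>A code determines its segment and hence its length; a segment shared by both branches
  cannot be long enough to include an index \<open>i\<close> at which \<open>S\<close> and
  \<open>S'\<close> differ.\<close>

lemma finite_branch_Int:
  assumes "S \<noteq> S'" shows "finite (branch S \<inter> branch S')"
proof -
  obtain i where i: "i \<in> S \<longleftrightarrow> i \<notin> S'" using assms by blast
  have "branch S \<inter> branch S' \<subseteq> (\<lambda>n. to_nat (map (\<lambda>i. i \<in> S) [0..<n])) ` {..i}"
  proof
    fix c assume "c \<in> branch S \<inter> branch S'"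
    then obtain m n where m: "c = to_nat (map (\<lambda>i. i \<in> S) [0..<m])"
      and n: "c = to_nat (map (\<lambda>i. i \<in> S') [0..<n])" unfolding branch_def by blast
    then have eq: "map (\<lambda>i. i \<in> S) [0..<m] = map (\<lambda>i. i \<in> S') [0..<n]" by simp
    have "m = n" using arg_cong[OF eq, of length] by simp
    have "m \<le> i"
    proof (rule ccontr)
      assume "\<not> m \<le> i"
      then show False using arg_cong[OF eq, of "\<lambda>l. l ! i"] i \<open>m = n\<close> by simp
    qed
    then show "c \<in> (\<lambda>n. to_nat (map (\<lambda>i. i \<in> S) [0..<n])) ` {..i}" using m by blast
  qed
  then show ?thesis by (rule finite_subset) simp
qed

text \<open>Countably many finite sets cannot exhaust the uncountable power set of the
  naturals.\<close>

lemma ex_outside_finite_sets: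
  fixes Bad :: "nat \<Rightarrow> nat set set"
  assumes "\<And>n. finite (Bad n)"
  shows "\<exists>S. \<forall>n. S \<notin> Bad n"
proof (rule ccontr)
  assume "\<not> ?thesis"
  then have "(\<Union>n. Bad n) = UNIV" by blast
  moreover have "countable (\<Union>n. Bad n)" using assms by (simp add: countable_finite)
  ultimately obtain g :: "nat \<Rightarrow> nat set" where "range g = UNIV"
    by (metis UNIV_not_empty uncountable_def)
  then show False using Cantors_theorem[of UNIV] by auto
qed

abbreviation ind :: "nat set \<Rightarrow> (nat \<Rightarrow>\<^sub>C 'k::real_normed_field)" where
  "ind A \<equiv> mask A (const_bcontfun 1)"

text \<open>A gliding hump over almost disjoint sets. Among the uncountably many sets
  \<open>A S\<close> of selected indices, each \<open>L n\<close> keeps large values on the tails of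
  only finitely many, so some \<open>S\<close> is good for all \<open>n\<close>. On
  \<open>ind (A S)\<close> the diagonal term then dominates for every \<open>n\<close> in the
  infinite set \<open>A S\<close>, against weak* convergence to zero.\<close>

theorem phillips_unit_seq:
  fixes L :: "nat \<Rightarrow> (nat \<Rightarrow>\<^sub>C 'k::{real_normed_field,euclidean_space}) \<Rightarrow> 'k"
  assumes L: "weak_star_null (scale_seq (*)) UNIV M L"
  shows "(\<lambda>n. L n (unit_seq n)) \<longlonglongrightarrow> 0"
proof (rule ccontr)
  let ?sc = "scale_seq (*) :: 'k \<Rightarrow> (nat \<Rightarrow>\<^sub>C 'k) \<Rightarrow> (nat \<Rightarrow>\<^sub>C 'k)"
  interpret k: banach_over "(*) :: 'k \<Rightarrow> 'k \<Rightarrow> 'k" by (rule banach_over_mult)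
  interpret C: banach_over ?sc by (rule k.banach_over_scale_seq)
  note lin = weak_star_nullD(2)[OF L]
  note L_bound = weak_star_nullD(3)[OF L UNIV_I]
  note L_add = bounded_linear_onD(1)[OF lin UNIV_I UNIV_I]
  have M: "0 \<le> M" by (rule weak_star_nullD(1)[OF L])
  assume "\<not> (\<lambda>n. L n (unit_seq n)) \<longlonglongrightarrow> 0"
  then obtain \<delta> where \<delta>: "\<delta> > 0" "\<exists>\<^sub>F n in sequentially. \<delta> \<le> norm (L n (unit_seq n))"
    by (rule not_tendsto_zeroE)
  \<comment> \<open>With disjoint supports, each coordinate sees at most one term.\<close>
  have norm_combination: "norm (\<Sum>t\<in>F. ?sc (a t) (ind (A t))) \<le> 1"
    if "finite F" "\<And>t. t \<in> F \<Longrightarrow> norm (a t) \<le> 1" "\<And>s t. s \<in> F \<Longrightarrow> t \<in> F \<Longrightarrow> s \<noteq> t \<Longrightarrow> A s \<inter> A t = {}"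
    for F :: "'i set" and a A
  proof (rule norm_bound)
    fix i
    have apply_sum: "apply_bcontfun (\<Sum>t\<in>F. ?sc (a t) (ind (A t))) i = (\<Sum>t\<in>F. if i \<in> A t then a t else 0)"
      unfolding apply_bcontfun_sum by (intro sum.cong) (auto simp: k.apply_scale_seq)
    show "norm (apply_bcontfun (\<Sum>t\<in>F. ?sc (a t) (ind (A t))) i) \<le> 1"
    proof (cases "\<exists>t\<in>F. i \<in> A t")
      case True
      then obtain t where t: "t \<in> F" "i \<in> A t" by blast
      have "(\<Sum>t\<in>F. if i \<in> A t then a t else 0) = (\<Sum>s\<in>F. if s = t then a s else 0)"
        using t that(3) by (intro sum.cong) auto
      then show ?thesis using that(1,2) t by (simp add: apply_sum)
    next
      case False
      then have "(\<Sum>t\<in>F. if i \<in> A t then a t else 0) = 0" by (intro sum.neutral) auto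
      then show ?thesis by (simp add: apply_sum)
    qed
  qed
  have wuc_unit: "wuc ?sc 1 unit_seq"
    unfolding wuc_def using norm_combination[of _ _ "\<lambda>n. {n}"] by blast
  have rows: "(\<lambda>n. L i (unit_seq n)) \<longlonglongrightarrow> 0" for i
    using C.summable_functional(2)[OF wuc_unit C.subspace_UNIV UNIV_I lin weak_star_nullD(3,1)[OF L]] .
  have cols: "(\<lambda>n. L n (unit_seq i)) \<longlonglongrightarrow> 0" for i
    using weak_star_nullD(4)[OF L UNIV_I] .
  have "\<delta>/4 > 0" using \<delta>(1) by simp
  from small_off_diagonal_subsequence[where a = "\<lambda>i n. L i (unit_seq n)", OF rows cols \<delta>(2) this]
  obtain r :: "nat \<Rightarrow> nat" where r: "strict_mono r" "\<And>k. \<delta> \<le> norm (L (r k) (unit_seq (r k)))"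
    "\<And>j F. finite F \<Longrightarrow> j \<notin> F \<Longrightarrow> (\<Sum>m\<in>F. norm (L (r j) (unit_seq (r m)))) \<le> \<delta>/4" by blast
  have inj: "inj r" using r(1) by (rule strict_mono_imp_inj_on)

  define A where "A S = r ` branch S" for S
  have A_inf: "infinite (A S)" for S
    unfolding A_def using infinite_branch inj by (simp add: finite_image_iff inj_on_subset)
  have A_Int: "finite (A S \<inter> A S')" if "S \<noteq> S'" for S S'
    unfolding A_def image_Int[OF inj, symmetric] using finite_branch_Int[OF that] by simp
  define Bad where
    "Bad n = {S. \<forall>\<^sub>F N in sequentially. \<delta>/4 < norm (L n (ind (A S - {..<N})))}" for n
  have "finite (Bad n)" for n
  proof (rule ccontr)
    assume "infinite (Bad n)"
    \<comment> \<open>Any \<open>p\<close> bad sets have disjoint tails beyond some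
      \<open>N\<close>; with rotating coefficients these tails form a vector of norm at most 1 on
      which \<open>L n\<close> would exceed \<open>M\<close>.\<close>
    obtain p :: nat where p: "M < real p * (\<delta>/4)"
      using reals_Archimedean3[of "\<delta>/4"] \<delta>(1) by auto
    obtain F where F: "F \<subseteq> Bad n" "finite F" "card F = p"
      using infinite_arbitrarily_large[OF \<open>infinite (Bad n)\<close>] by blast
    have ev1: "\<forall>\<^sub>F N in sequentially. \<forall>S\<in>F. \<delta>/4 < norm (L n (ind (A S - {..<N})))"
      using F by (intro eventually_ball_finite) (auto simp: Bad_def)
    have ev: "\<forall>\<^sub>F N in sequentially. S \<noteq> S' \<longrightarrow> (A S - {..<N}) \<inter> (A S' - {..<N}) = {}" for S S'
    proof (cases "S = S'")
      case False
      then obtain N0 where "\<And>i. i \<in> A S \<inter> A S' \<Longrightarrow> i < N0"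
        using A_Int by (meson finite_nat_iff_bounded lessThan_iff subsetD)
      then show ?thesis
        by (intro eventually_sequentiallyI[of N0]) fastforce
    qed simp
    have "\<forall>\<^sub>F N in sequentially. \<forall>S\<in>F. \<forall>S'\<in>F. S \<noteq> S' \<longrightarrow> (A S - {..<N}) \<inter> (A S' - {..<N}) = {}"
      using F(2) by (intro eventually_ball_finite ballI ev)
    from eventually_happens'[OF sequentially_bot eventually_conj[OF ev1 this]]
    obtain N where "(\<forall>S\<in>F. \<delta>/4 < norm (L n (ind (A S - {..<N})))) \<and>
      (\<forall>S\<in>F. \<forall>S'\<in>F. S \<noteq> S' \<longrightarrow> (A S - {..<N}) \<inter> (A S' - {..<N}) = {})" ..
    then have N: "\<And>S. S \<in> F \<Longrightarrow> \<delta>/4 < norm (L n (ind (A S - {..<N})))"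
      "\<And>S S'. S \<in> F \<Longrightarrow> S' \<in> F \<Longrightarrow> S \<noteq> S' \<Longrightarrow> (A S - {..<N}) \<inter> (A S' - {..<N}) = {}"
      by blast+
    define c where "c S = unit_conj (L n (ind (A S - {..<N})))" for S
    let ?g = "\<Sum>S\<in>F. ?sc (c S) (ind (A S - {..<N}))"
    have "L n ?g = (\<Sum>S\<in>F. c S * L n (ind (A S - {..<N})))"
      using F(2) by (intro C.bounded_linear_on_combination[OF banach_over_mult lin]) auto
    also have "\<dots> = of_real (\<Sum>S\<in>F. norm (L n (ind (A S - {..<N}))))"
      by (simp add: c_def unit_conj_mult)
    finally have "(\<Sum>S\<in>F. norm (L n (ind (A S - {..<N})))) = norm (L n ?g)"
      by (simp add: sum_nonneg del: of_real_sum)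
    also have "\<dots> \<le> M * norm ?g" by (rule L_bound)
    also have "\<dots> \<le> M * 1"
      using F(2) N(2) M by (intro mult_left_mono norm_combination) (auto simp: c_def norm_unit_conj_le)
    finally have "(\<Sum>S\<in>F. norm (L n (ind (A S - {..<N})))) \<le> M" by simp
    moreover have "real p * (\<delta>/4) \<le> (\<Sum>S\<in>F. norm (L n (ind (A S - {..<N}))))"
      using sum_bounded_below[of F "\<delta>/4"] N(1) F(3) by (simp add: less_imp_le)
    ultimately show False using p by simp
  qed
  then obtain S where S: "\<And>n. S \<notin> Bad n" using ex_outside_finite_sets by blast

  \<comment> \<open>\<open>A S\<close> falls into three pieces: \<open>n\<close> itself contributes
    at least \<delta>, the finitely many other elements below \<open>N\<close> at most \<delta>/4 by
    the choice of \<open>r\<close>, and the tail from \<open>N\<close> on at most \<delta>/4 because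
    \<open>S\<close> is not bad.\<close>
  have large: "\<delta>/2 \<le> norm (L n (ind (A S)))" if n: "n \<in> A S" for n
  proof -
    obtain j where j: "j \<in> branch S" "n = r j" using n by (auto simp: A_def)
    have "\<exists>\<^sub>F N in sequentially. norm (L n (ind (A S - {..<N}))) \<le> \<delta>/4"
      using S[of n] by (simp add: Bad_def not_eventually not_less)
    \<comment> \<open>A small tail occurs for arbitrarily large \<open>N\<close>, so
      \<open>N\<close> can be taken beyond \<open>n\<close>.\<close>
    then obtain N where N: "n < N" "norm (L n (ind (A S - {..<N}))) \<le> \<delta>/4"
      using frequently_ex[OF frequently_eventually_frequently[OF _ eventually_gt_at_top[of n]]] by blast
    define F where "F = {i \<in> branch S. r i < N} - {j}"
    have "finite {i. r i < N}"
      using finite_vimageI[OF finite_lessThan[of N] inj] by (simp add: vimage_def)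
    then have F: "finite F" unfolding F_def by (rule rev_finite_subset) auto
    have "A S = {n} \<union> (r ` F \<union> (A S - {..<N}))"
      using j N(1) by (auto simp: A_def F_def)
    moreover have "{n} \<inter> (r ` F \<union> (A S - {..<N})) = {}" "r ` F \<inter> (A S - {..<N}) = {}"
      using j N(1) inj by (auto simp: F_def inj_eq)
    ultimately have "ind (A S) = unit_seq n + (ind (r ` F) + (ind (A S - {..<N}) :: nat \<Rightarrow>\<^sub>C 'k))"
      by (metis mask_Un_disjoint)
    then have split: "L n (ind (A S)) = L n (unit_seq n) + (L n (ind (r ` F)) + L n (ind (A S - {..<N})))"
      by (simp only: L_add)
    have "ind (r ` F) = (\<Sum>i\<in>r ` F. mask {i} (ind (r ` F) :: nat \<Rightarrow>\<^sub>C 'k))"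
      using mask_finite[of "r ` F" "ind (r ` F)"] F by simp
    also have "\<dots> = (\<Sum>i\<in>F. ?sc 1 (unit_seq (r i)))"
      using inj by (subst sum.reindex) (auto intro: inj_on_subset intro!: sum.cong)
    finally have "L n (ind (r ` F)) = (\<Sum>i\<in>F. 1 * L n (unit_seq (r i)))"
      using C.bounded_linear_on_combination[OF banach_over_mult lin C.subspace_UNIV F UNIV_I, where x = "\<lambda>i. unit_seq (r i)" and a = "\<lambda>_. 1"]
      by simp
    then have "norm (L n (ind (r ` F))) \<le> (\<Sum>i\<in>F. norm (L n (unit_seq (r i))))"
      by (simp add: norm_sum)
    also have "\<dots> \<le> \<delta>/4"
      unfolding j(2) using F by (intro r(3)) (auto simp: F_def)
    finally have "norm (L n (ind (r ` F)) + L n (ind (A S - {..<N}))) \<le> \<delta>/2"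
      using N(2) norm_triangle_ineq[of "L n (ind (r ` F))" "L n (ind (A S - {..<N}))"] by simp
    moreover have "\<delta> \<le> norm (L n (unit_seq n))" using r(2) j by simp
    ultimately show ?thesis
      using norm_diff_ineq[of "L n (unit_seq n)" "L n (ind (r ` F)) + L n (ind (A S - {..<N}))"]
      by (simp add: split)
  qed
  have "\<forall>\<^sub>F n in sequentially. norm (L n (ind (A S))) < \<delta>/2"
    using tendstoD[OF weak_star_nullD(4)[OF L UNIV_I], of "\<delta>/2"] \<delta>(1) by simp
  then obtain N where "\<And>n. n \<ge> N \<Longrightarrow> norm (L n (ind (A S))) < \<delta>/2"
    by (auto simp: eventually_sequentially)
  then have "A S \<subseteq> {..<N}" using large by (meson lessThan_iff not_le subsetI)
  then show False using A_inf finite_subset by blast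
qed

section \<open>Separating points by functionals\<close>

text \<open>Zorn's lemma is applied to graphs, so that extending a functional is enlarging a set.
  The one-sided bound on a subspace already forces single-valuedness and the two-sided
  bound.\<close>

theorem hahn_banach_norming_functional:
  fixes v :: "'a::real_normed_vector"
  shows "\<exists>u :: 'a \<Rightarrow> real. linear u \<and> (\<forall>x. \<bar>u x\<bar> \<le> norm x) \<and> u v = norm v"
proof -
  text \<open>The graphs of norm-decreasing functionals on subspaces containing \<open>v\<close>.\<close>
  define \<A> where "\<A> = {G :: ('a \<times> real) set. subspace G \<and> (v, norm v) \<in> G \<and> (\<forall>(x, r)\<in>G. r \<le> norm x)}"
  have "span {(v, norm v)} \<in> \<A>"
    unfolding \<A>_def
  proof (intro CollectI conjI subspace_span)
    show "\<forall>(x, r)\<in>span {(v, norm v)}. r \<le> norm x"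
      by (auto simp: span_singleton mult_right_mono)
  qed (simp add: span_base)
  then have "\<A> \<noteq> {}" by blast
  moreover have "\<Union>\<C> \<in> \<A>" if \<C>: "\<C> \<noteq> {}" "subset.chain \<A> \<C>" for \<C>
  proof -
    have in\<A>: "G \<in> \<A>" if "G \<in> \<C>" for G using \<C>(2) that by (auto simp: subset.chain_def)
    then have sub: "subspace G" and vG: "(v, norm v) \<in> G" and le: "\<forall>(x, r)\<in>G. r \<le> norm x"
      if "G \<in> \<C>" for G using that by (simp_all add: \<A>_def)
    have "subspace (\<Union>\<C>)"
    proof (rule subspaceI)
      show "0 \<in> \<Union>\<C>" using \<C>(1) sub subspace_0 by blast
    next
      fix p q assume "p \<in> \<Union>\<C>" "q \<in> \<Union>\<C>"
      then obtain G H where GH: "G \<in> \<C>" "p \<in> G" "H \<in> \<C>" "q \<in> H" by blast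
      moreover have "G \<subseteq> H \<or> H \<subseteq> G" using \<C>(2) GH by (auto simp: subset.chain_def)
      ultimately obtain I where I: "I \<in> \<C>" "p \<in> I" "q \<in> I" by blast
      from subspace_add[OF sub[OF this(1)] this(2,3)] show "p + q \<in> \<Union>\<C>" using I by blast
    next
      fix c p assume "p \<in> \<Union>\<C>"
      then obtain G where G: "G \<in> \<C>" "p \<in> G" by blast
      from subspace_scale[OF sub[OF this(1)] this(2)] show "c *\<^sub>R p \<in> \<Union>\<C>" using G by blast
    qed
    moreover have "(v, norm v) \<in> \<Union>\<C>" using \<C>(1) vG by blast
    moreover have "\<forall>(x, r)\<in>\<Union>\<C>. r \<le> norm x" using le by blast
    ultimately show ?thesis by (simp add: \<A>_def)
  qed
  ultimately obtain G where G: "G \<in> \<A>" and max: "\<And>H. H \<in> \<A> \<Longrightarrow> G \<subseteq> H \<Longrightarrow> H = G"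
    using subset_Zorn_nonempty[of \<A>] by blast
  have sub: "subspace G" and vG: "(v, norm v) \<in> G" and le: "\<And>x r. (x, r) \<in> G \<Longrightarrow> r \<le> norm x"
    using G by (auto simp: \<A>_def)
  have add: "(x + y, r + s) \<in> G" if "(x, r) \<in> G" "(y, s) \<in> G" for x r y s
    using subspace_add[OF sub that] by simp
  have mult: "(c *\<^sub>R x, c * r) \<in> G" if "(x, r) \<in> G" for x r c
    using subspace_scale[OF sub that, of c] by simp
  have total: "\<exists>r. (z, r) \<in> G" for z
  proof -
    \<comment> \<open>The value at \<open>z\<close> must lie between all
      \<open>r - norm (y - z)\<close> and all \<open>norm (y + z) - r\<close>; the triangle
      inequality separates the two families, and the supremum of the first is taken.\<close>
    define c where "c = (SUP (y, r)\<in>G. r - norm (y - z))"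
    have ub: "r - norm (y - z) \<le> norm (y' + z) - r'" if "(y, r) \<in> G" "(y', r') \<in> G" for y r y' r'
      using le[OF add[OF that]] norm_triangle_ineq[of "y - z" "y' + z"] by simp
    have c1: "r - norm (y - z) \<le> c" if "(y, r) \<in> G" for y r
      unfolding c_def using that ub[OF _ vG]
      by (intro cSUP_upper2[of _ _ "(y, r)"] bdd_aboveI2[of _ _ "norm (v + z) - norm v"]) auto
    have c2: "c \<le> norm (y + z) - r" if "(y, r) \<in> G" for y r
      unfolding c_def using vG ub[OF _ that] by (intro cSUP_least) auto
    define H where "H = span (insert (z, c) G)"
    have H: "\<exists>y s k. (y, s) \<in> G \<and> x = y + k *\<^sub>R z \<and> r = s + k * c" if "(x, r) \<in> H" for x r
    proof -
      obtain k where "(x, r) - k *\<^sub>R (z, c) \<in> span G"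
        using \<open>(x, r) \<in> H\<close> by (auto simp: H_def span_insert)
      then have "(x - k *\<^sub>R z, r - k * c) \<in> G" using span_eq_iff[THEN iffD2, OF sub] by simp
      then show ?thesis by (intro exI[of _ "x - k *\<^sub>R z"] exI[of _ "r - k * c"] exI[of _ k]) simp
    qed
    \<comment> \<open>Dividing by the modulus of \<open>k\<close> reduces this to adding or
      subtracting \<open>z\<close> itself, which are the bounds \<open>c2\<close> and
      \<open>c1\<close>.\<close>
    have ext: "s + k * c \<le> norm (y + k *\<^sub>R z)" if ys: "(y, s) \<in> G" for y s k
    proof -
      consider "k = 0" | "k > 0" | "k < 0" by linarith
      then show ?thesis
      proof cases
        case 1
        then show ?thesis using le[OF ys] by simp
      next
        case 2
        have "k * c \<le> k * (norm ((1/k) *\<^sub>R y + z) - (1/k) * s)"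
          using c2[OF mult[OF ys, of "1/k"]] 2 by (rule mult_left_mono[OF _ less_imp_le])
        also have "\<dots> = norm (k *\<^sub>R ((1/k) *\<^sub>R y + z)) - s"
          using 2 by (simp add: right_diff_distrib)
        also have "k *\<^sub>R ((1/k) *\<^sub>R y + z) = y + k *\<^sub>R z"
          using 2 by (simp add: scaleR_add_right)
        finally show ?thesis by simp
      next
        case 3
        have "(-k) * ((-1/k) * s - norm ((-1/k) *\<^sub>R y - z)) \<le> (-k) * c"
          using c1[OF mult[OF ys, of "-1/k"]] 3 by (intro mult_left_mono) auto
        also have "(-k) * ((-1/k) * s - norm ((-1/k) *\<^sub>R y - z)) = s - norm ((-k) *\<^sub>R ((-1/k) *\<^sub>R y - z))"
          using 3 by (simp add: right_diff_distrib)
        also have "(-k) *\<^sub>R ((-1/k) *\<^sub>R y - z) = y + k *\<^sub>R z"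
          using 3 by (simp add: scaleR_diff_right)
        finally show ?thesis by simp
      qed
    qed
    have "H \<in> \<A>"
      unfolding \<A>_def
    proof (intro CollectI conjI)
      show "subspace H" "(v, norm v) \<in> H" using vG by (simp_all add: H_def span_base)
      show "\<forall>(x, r)\<in>H. r \<le> norm x"
      proof clarify
        fix x r assume "(x, r) \<in> H"
        from H[OF this] obtain y s k where "(y, s) \<in> G" "x = y + k *\<^sub>R z" "r = s + k * c" by blast
        then show "r \<le> norm x" using ext by simp
      qed
    qed
    then have "H = G" by (rule max) (auto simp: H_def span_base)
    moreover have "(z, c) \<in> H" by (simp add: H_def span_base)
    ultimately show ?thesis by blast
  qed
  \<comment> \<open>Two values at \<open>x\<close> put \<open>(0, r - s)\<close> and
    \<open>(0, s - r)\<close> into \<open>G\<close>, where the bound is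
    \<open>norm 0\<close>.\<close>
  have unique: "r = s" if "(x, r) \<in> G" "(x, s) \<in> G" for x r s
    using le[OF add[OF that(1) mult[OF that(2), of "-1"]]] le[OF add[OF that(2) mult[OF that(1), of "-1"]]]
    by simp
  define u where "u x = (SOME r. (x, r) \<in> G)" for x
  have u: "(x, u x) \<in> G" for x unfolding u_def using total[of x] by (rule someI_ex)
  have u_eq: "u x = r" if "(x, r) \<in> G" for x r using unique[OF u that] .
  have "linear u"
    by (rule linearI) (auto intro!: u_eq add mult u)
  moreover have "\<bar>u x\<bar> \<le> norm x" for x
    using le[OF u[of x]] le[OF mult[OF u[of x], of "-1"]] by simp
  moreover have "u v = norm v" using vG by (rule u_eq)
  ultimately show ?thesis by blast
qed

section \<open>From real functionals to functionals over \<open>'k\<close>\<close>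

context banach_over
begin

text \<open>Additivity gives the identity for rational \<open>r\<close>; by
  \<open>norm_scale\<close> the left side is continuous in \<open>r\<close>, and the rationals are
  dense.\<close>

lemma scale_of_real: "scale (of_real r) x = r *\<^sub>R x"
proof -
  have nat: "scale (of_nat n) x = of_nat n *\<^sub>R x" for n x
    by (induct n) (simp_all add: scale_left_distrib scaleR_add_left)
  have int: "scale (of_int i) x = of_int i *\<^sub>R x" for i x
    by (cases i rule: int_cases2) (simp_all add: nat)
  have rat: "scale (of_real q) x - q *\<^sub>R x = 0" if "q \<in> \<rat>" for q
  proof -
    obtain a b :: int where q: "b > 0" "q = of_int a / of_int b" using \<open>q \<in> \<rat>\<close> by (rule Rats_cases')
    have "of_int b *\<^sub>R scale (of_real q) x = scale (of_int b * of_real q) x"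
      by (simp flip: int)
    also have "of_int b * of_real q = (of_int a :: 'k)" using q by simp
    also have "scale (of_int a) x = of_int b *\<^sub>R (q *\<^sub>R x)" using q by (simp add: int)
    finally show ?thesis using q(1) by (simp del: scaleR_scaleR)
  qed
  have "continuous_on UNIV (\<lambda>r. scale (of_real r) x)"
    unfolding continuous_on_def
  proof
    fix r :: real
    have eq: "norm (scale (of_real s) x - scale (of_real r) x) = \<bar>s - r\<bar> * norm x" for s
      by (simp only: scale_left_diff_distrib[symmetric] of_real_diff[symmetric] norm_scale norm_of_real)
    have "((\<lambda>s. \<bar>s - r\<bar> * norm x) \<longlongrightarrow> \<bar>r - r\<bar> * norm x) (at r)"
      by (intro tendsto_intros)
    then have "((\<lambda>s. norm (scale (of_real s) x - scale (of_real r) x)) \<longlongrightarrow> 0) (at r)"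
      unfolding eq by simp
    then have "((\<lambda>s. scale (of_real s) x - scale (of_real r) x) \<longlongrightarrow> 0) (at r)"
      by (rule tendsto_norm_zero_cancel)
    then show "((\<lambda>r. scale (of_real r) x) \<longlongrightarrow> scale (of_real r) x) (at r within UNIV)"
      by (rule LIM_zero_cancel)
  qed
  then have "continuous_on UNIV (\<lambda>r. scale (of_real r) x - r *\<^sub>R x)"
    by (intro continuous_intros)
  then have "continuous_on (closure \<rat>) (\<lambda>r. scale (of_real r) x - r *\<^sub>R x)"
    by (simp add: Rats_closure_real)
  from continuous_constant_on_closure[OF this rat, of r]
  have "scale (of_real r) x - r *\<^sub>R x = 0"
    by (simp add: Rats_closure_real)
  then show ?thesis by simp
qed

text \<open>A real functional \<open>u\<close> becomes \<open>'k\<close>-linear by representing \<open>\<lambda>b. u (scale b x)\<close> through the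
  form \<open>(a, b) \<mapsto> (a * b) \<bullet> 1\<close> on \<open>'k\<close>, which is nondegenerate since \<open>'k\<close> is a field.\<close>

lemma ex_functional_nonzero:
  assumes "x0 \<noteq> 0"
  obtains \<phi> C where "bounded_linear_on scale (*) UNIV \<phi>" "\<And>x. norm (\<phi> x) \<le> C * norm x" "0 \<le> C" "\<phi> x0 \<noteq> 0"
proof -
  obtain u :: "'a \<Rightarrow> real" where u: "linear u" "\<And>x. \<bar>u x\<bar> \<le> norm x" "u x0 = norm x0"
    using hahn_banach_norming_functional[of x0] by blast
  \<comment> \<open>Testing the difference at its inverse gives \<open>1 \<bullet> 1\<close>, which
    is not zero.\<close>
  have nondeg: "a = a'" if "\<And>b. (a * b) \<bullet> 1 = (a' * b) \<bullet> (1::'k)" for a a'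
  proof (rule ccontr)
    assume "a \<noteq> a'"
    then have "((a - a') * inverse (a - a')) \<bullet> 1 = (1::'k) \<bullet> 1" by simp
    moreover have "((a - a') * inverse (a - a')) \<bullet> 1 = 0"
      using that[of "inverse (a - a')"] by (simp only: left_diff_distrib inner_diff_left)
    ultimately show False by simp
  qed
  have lin_form: "linear (\<lambda>b. (a * b) \<bullet> (1::'k))" for a :: 'k
    by (rule linearI) (simp_all add: distrib_left inner_add_left)
  have lin_u: "linear (\<lambda>b. u (scale b x))" for x
    by (rule linearI)
      (simp_all add: scale_left_distrib linear_add[OF u(1)] linear_scale[OF u(1)] scaleR_conv_of_real
        scale_of_real flip: scale_scale)
  \<comment> \<open>The coordinates of \<open>\<Phi> a\<close> are the basis values of the
    functional that \<open>a\<close> induces through the form. Being injective on a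
    finite-dimensional space, \<open>\<Phi>\<close> is onto, so every real functional on
    \<open>'k\<close> is induced in this way.\<close>
  define \<Phi> :: "'k \<Rightarrow> 'k" where "\<Phi> a = (\<Sum>e\<in>Basis. ((a * e) \<bullet> 1) *\<^sub>R e)" for a
  have \<Phi>_inner: "\<Phi> a \<bullet> e = (a * e) \<bullet> 1" if "e \<in> Basis" for a e
    using that by (simp add: \<Phi>_def)
  have "linear \<Phi>"
    by (rule linearI) (simp_all add: \<Phi>_def distrib_right inner_add_left scaleR_add_left sum.distrib scaleR_sum_right)
  moreover have "inj \<Phi>"
  proof (rule injI)
    fix a a' assume "\<Phi> a = \<Phi> a'"
    then have "(a * e) \<bullet> 1 = (a' * e) \<bullet> 1" if "e \<in> Basis" for e
      using \<Phi>_inner[OF that] by metis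
    then have "(\<lambda>b. (a * b) \<bullet> 1) = (\<lambda>b. (a' * b) \<bullet> 1)"
      by (intro linear_eq_stdbasis lin_form)
    then show "a = a'" by (intro nondeg) (simp add: fun_eq_iff)
  qed
  ultimately have "surj \<Phi>" by (rule linear_inj_imp_surj)
  have ex: "\<exists>a. \<forall>b. (a * b) \<bullet> 1 = u (scale b x)" for x
  proof -
    obtain a where a: "\<Phi> a = (\<Sum>e\<in>Basis. u (scale e x) *\<^sub>R e)" using \<open>surj \<Phi>\<close> by (metis surjD)
    have "(a * e) \<bullet> 1 = u (scale e x)" if "e \<in> Basis" for e
      using \<Phi>_inner[OF that, of a] that by (simp add: a)
    then have "(\<lambda>b. (a * b) \<bullet> 1) = (\<lambda>b. u (scale b x))"
      by (intro linear_eq_stdbasis lin_form lin_u)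
    then show ?thesis by (auto simp: fun_eq_iff)
  qed
  define \<phi> where "\<phi> x = (SOME a. \<forall>b. (a * b) \<bullet> 1 = u (scale b x))" for x
  have \<phi>: "(\<phi> x * b) \<bullet> 1 = u (scale b x)" for x b
    using someI_ex[OF ex[of x]] by (simp add: \<phi>_def)
  \<comment> \<open>Multiplication by \<open>unit_conj (\<phi> x)\<close> turns
    \<open>\<phi> x\<close> into its modulus, whose pairing with 1 is that modulus.\<close>
  have bound: "norm (\<phi> x) \<le> 1 * norm x" for x
  proof -
    have "norm (\<phi> x) = u (scale (unit_conj (\<phi> x)) x)"
      using \<phi>[of x "unit_conj (\<phi> x)"] by (simp add: mult.commute[of "\<phi> x"] unit_conj_mult of_real_def dot_square_norm)
    also have "\<dots> \<le> norm (scale (unit_conj (\<phi> x)) x)" using u(2) abs_le_D1 by blast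
    also have "\<dots> \<le> 1 * norm x"
      unfolding norm_scale by (intro mult_right_mono norm_unit_conj_le) simp
    finally show ?thesis .
  qed
  show ?thesis
  proof (rule that[of \<phi> 1])
    show "bounded_linear_on scale (*) UNIV \<phi>"
    proof (rule bounded_linear_onI)
      show "\<phi> (x + y) = \<phi> x + \<phi> y" for x y
        by (rule nondeg) (simp add: \<phi> distrib_right inner_add_left scale_right_distrib linear_add[OF u(1)])
      show "\<phi> (scale c x) = c * \<phi> x" for c x
        by (rule nondeg) (simp add: \<phi> mult.commute[of c] mult.assoc)
    qed (rule bound)
    show "\<phi> x0 \<noteq> 0" using \<phi>[of x0 1] u(3) assms by auto
  qed (use bound in auto)
qed

end

section \<open>Transfer along bounded operators\<close>

lemma weak_star_null_comp:
  assumes f: "weak_star_null t W M f" and V: "bounded_linear_on s t U V"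
    and VW: "\<And>w. w \<in> U \<Longrightarrow> V w \<in> W" and V_bound: "\<And>w. w \<in> U \<Longrightarrow> norm (V w) \<le> N * norm w" and "0 \<le> N"
  shows "weak_star_null s U (M * N) (\<lambda>n w. f n (V w))"
  unfolding weak_star_null_def
proof (intro conjI allI ballI)
  have M: "0 \<le> M" by (rule weak_star_nullD(1)[OF f])
  then show "0 \<le> M * N" using \<open>0 \<le> N\<close> by simp
  show bound: "norm (f n (V w)) \<le> M * N * norm w" if "w \<in> U" for n w
    using order_trans[OF weak_star_nullD(3)[OF f VW[OF that]] mult_left_mono[OF V_bound[OF that] M]]
    by (simp add: mult.assoc)
  show "bounded_linear_on s (*) U (\<lambda>w. f n (V w))" for n
    by (rule bounded_linear_onI[OF _ _ bound])
      (simp_all add: bounded_linear_onD[OF V] bounded_linear_onD[OF weak_star_nullD(2)[OF f]] VW)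
  show "(\<lambda>n. f n (V w)) \<longlonglongrightarrow> 0" if "w \<in> U" for w
    using weak_star_nullD(4)[OF f VW[OF that]] .
qed

lemma (in banach_over) wuc_image:
  assumes x: "wuc scale K x" "\<And>n. x n \<in> W" "subspace W" and t: "banach_over t"
    and V: "bounded_linear_on scale t W V" "\<And>w. w \<in> W \<Longrightarrow> norm (V w) \<le> N * norm w" "0 \<le> N"
  shows "wuc t (N * K) (\<lambda>n. V (x n))"
  unfolding wuc_def
proof (intro allI impI)
  fix a :: "nat \<Rightarrow> 'k" and F :: "nat set" assume F: "finite F" "\<forall>n\<in>F. norm (a n) \<le> 1"
  have "(\<Sum>n\<in>F. t (a n) (V (x n))) = V (\<Sum>n\<in>F. scale (a n) (x n))"
    using bounded_linear_on_combination[OF t V(1) x(3) F(1) x(2)] by simp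
  also have "norm \<dots> \<le> N * norm (\<Sum>n\<in>F. scale (a n) (x n))"
    using x(2,3) by (intro V(2) subspace_sum subspace_scale)
  also have "\<dots> \<le> N * K"
    using F V(3) by (intro mult_left_mono wucD[OF x(1)]) auto
  finally show "norm (\<Sum>n\<in>F. t (a n) (V (x n))) \<le> N * K" .
qed

lemma (in banach_over) wuc_norm_le:
  assumes "wuc scale K x" shows "norm (x n) \<le> K"
  using wucD[OF assms, of "{n}" "\<lambda>_. 1"] by simp

lemma (in banach_over) bounded_linear_on_entry:
  "bounded_linear_on (scale_seq scale) scale W (\<lambda>w. apply_bcontfun w i)"
  by (rule bounded_linear_onI[where K = 1]) (simp_all add: apply_scale_seq norm_bounded)

lemma (in banach_over) bounded_linear_on_single:
  "bounded_linear_on scale (scale_seq scale) W (\<lambda>v. mask {i} (const_bcontfun v))"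
  "norm (mask {i} (const_bcontfun v)) \<le> 1 * norm v"
proof -
  show bound: "norm (mask {i} (const_bcontfun v)) \<le> 1 * norm v" for v
    by (rule norm_bound) auto
  show "bounded_linear_on scale (scale_seq scale) W (\<lambda>v. mask {i} (const_bcontfun v))"
    by (rule bounded_linear_onI[OF _ _ bound]; rule bcontfun_eqI) (auto simp: apply_scale_seq)
qed

lemma single_in_c0_ideal: "ideal_on_omega \<I> \<Longrightarrow> mask {i} (const_bcontfun v) \<in> c0_ideal \<I>"
  by (rule c0_ideal_supported[of _ "{i}"]) (auto simp: ideal_finite)

section \<open>Complemented copies of \<open>c\<^sub>0\<close> inherited by the vector-valued space\<close>

context banach_over
begin

text \<open>The space embeds as coordinate 0, and evaluation there is a left inverse, so both
  sequences of the criterion carry over with the same diagonal.\<close>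

lemma complemented_in_c0_ideal_of_space:
  assumes I: "ideal_on_omega \<I>"
    and "complemented_copy (scale_seq (*)) (c0 :: (nat \<Rightarrow>\<^sub>C 'k) set) scale UNIV"
  shows "complemented_copy (scale_seq (*)) (c0 :: (nat \<Rightarrow>\<^sub>C 'k) set) (scale_seq scale) (c0_ideal \<I>)"
proof -
  interpret S: banach_over "scale_seq scale" by (rule banach_over_scale_seq)
  obtain K x M f where x: "wuc scale K x" "\<And>n. x n \<in> UNIV" and f: "weak_star_null scale UNIV M f"
    and fx: "\<And>m n. f m (x n) = (if m = n then 1 else 0)"
    using complemented_c0D[OF subspace_UNIV assms(2)] by blast
  show ?thesis
  proof (rule S.complemented_c0I[OF subspace_c0_ideal[OF I] closed_c0_ideal[OF I]])
    show "wuc (scale_seq scale) (1 * K) (\<lambda>n. mask {0} (const_bcontfun (x n)))"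
      by (rule wuc_image[OF x subspace_UNIV banach_over_scale_seq bounded_linear_on_single]) simp
    show "weak_star_null (scale_seq scale) (c0_ideal \<I>) (M * 1) (\<lambda>n w. f n (apply_bcontfun w 0))"
      by (rule weak_star_null_comp[OF f bounded_linear_on_entry]) (auto simp: norm_bounded)
    show "\<not> (\<lambda>n. f n (apply_bcontfun (mask {0} (const_bcontfun (x n))) 0)) \<longlonglongrightarrow> 0"
      by (simp add: fx LIMSEQ_const_iff)
  qed (rule single_in_c0_ideal[OF I])
qed

text \<open>\<open>V\<close> embeds the scalar space along \<open>v\<close>, and \<open>R\<close>
  applies entrywise a functional with \<open>\<phi> v \<noteq> 0\<close>. As \<open>R\<close> after
  \<open>V\<close> is multiplication by \<open>\<phi> v\<close>, all diagonal values equal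
  \<open>\<phi> v\<close>.\<close>

lemma complemented_in_c0_ideal_of_scalar:
  assumes I: "ideal_on_omega \<I>" and v: "v \<noteq> (0::'a)"
    and "complemented_copy (scale_seq (*)) (c0 :: (nat \<Rightarrow>\<^sub>C 'k) set)
        (scale_seq (*)) (c0_ideal \<I> :: (nat \<Rightarrow>\<^sub>C 'k) set)"
  shows "complemented_copy (scale_seq (*)) (c0 :: (nat \<Rightarrow>\<^sub>C 'k) set) (scale_seq scale) (c0_ideal \<I>)"
proof -
  let ?sc = "scale_seq (*) :: 'k \<Rightarrow> (nat \<Rightarrow>\<^sub>C 'k) \<Rightarrow> (nat \<Rightarrow>\<^sub>C 'k)"
  let ?W = "c0_ideal \<I> :: (nat \<Rightarrow>\<^sub>C 'k) set"
  interpret S: banach_over "scale_seq scale" by (rule banach_over_scale_seq)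
  interpret k: banach_over "(*) :: 'k \<Rightarrow> 'k \<Rightarrow> 'k" by (rule banach_over_mult)
  interpret C: banach_over ?sc by (rule k.banach_over_scale_seq)
  obtain K x M f where x: "wuc ?sc K x" "\<And>n. x n \<in> ?W" and f: "weak_star_null ?sc ?W M f"
    and fx: "\<And>m n. f m (x n) = (if m = n then 1 else 0)"
    using C.complemented_c0D[OF k.subspace_c0_ideal[OF I] assms(3)] by blast
  obtain \<phi> N where \<phi>: "bounded_linear_on scale (*) UNIV \<phi>" "\<And>x. norm (\<phi> x) \<le> N * norm x" "0 \<le> N" "\<phi> v \<noteq> 0"
    using ex_functional_nonzero[OF v] by blast
  note \<phi>_lin = bounded_linear_onD[OF \<phi>(1) UNIV_I]
  define V where "V g = (Bcontfun (\<lambda>i. scale (apply_bcontfun g i) v) :: nat \<Rightarrow>\<^sub>C 'a)" for g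
  have V: "apply_bcontfun (V g) i = scale (apply_bcontfun g i) v" for g i
    unfolding V_def
    by (subst apply_Bcontfun[of _ "norm g * norm v"]) (auto simp: norm_scale norm_bounded mult_right_mono)
  have V_bound: "norm (V g) \<le> norm v * norm g" for g
    by (rule norm_bound) (simp add: V norm_scale norm_bounded mult.commute[of "norm v"] mult_right_mono)
  have V_lin: "bounded_linear_on ?sc (scale_seq scale) ?W V"
    by (rule bounded_linear_onI[OF _ _ V_bound]; rule bcontfun_eqI)
      (simp_all add: V scale_left_distrib apply_scale_seq k.apply_scale_seq)
  define R where "R w = (Bcontfun (\<lambda>i. \<phi> (apply_bcontfun w i)) :: nat \<Rightarrow>\<^sub>C 'k)" for w
  have R_le: "norm (\<phi> (apply_bcontfun w i)) \<le> N * norm w" for w i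
    using order_trans[OF \<phi>(2) mult_left_mono[OF norm_bounded \<phi>(3)]] .
  have R: "apply_bcontfun (R w) i = \<phi> (apply_bcontfun w i)" for w i
    unfolding R_def by (subst apply_Bcontfun[OF R_le]) simp
  have R_bound: "norm (R w) \<le> N * norm w" for w
    by (rule norm_bound) (simp add: R R_le)
  have R_lin: "bounded_linear_on (scale_seq scale) ?sc (c0_ideal \<I>) R"
    by (rule bounded_linear_onI[OF _ _ R_bound]; rule bcontfun_eqI)
      (simp_all add: R \<phi>_lin apply_scale_seq k.apply_scale_seq)
  have R_W: "R w \<in> ?W" if "w \<in> c0_ideal \<I>" for w
  proof (rule c0_ideal_dominated[OF I])
    interpret S: banach_over "scale_seq scale" by (rule banach_over_scale_seq)
    show "scale_seq scale (of_real N) w \<in> c0_ideal \<I>"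
      using S.subspace_scale[OF subspace_c0_ideal[OF I] that] .
    show "norm (apply_bcontfun (R w) i) \<le> norm (apply_bcontfun (scale_seq scale (of_real N) w) i)" for i
      using \<phi>(2,3) by (simp add: R apply_scale_seq norm_scale)
  qed
  have V_W: "V g \<in> c0_ideal \<I>" if "g \<in> ?W" for g
  proof (rule c0_ideal_dominated[OF I])
    show "?sc (of_real (norm v)) g \<in> ?W"
      using C.subspace_scale[OF k.subspace_c0_ideal[OF I] that] .
    show "norm (apply_bcontfun (V g) i) \<le> norm (apply_bcontfun (?sc (of_real (norm v)) g) i)" for i
      by (simp add: V k.apply_scale_seq norm_scale norm_mult)
  qed
  show ?thesis
  proof (rule S.complemented_c0I[OF subspace_c0_ideal[OF I] closed_c0_ideal[OF I]])
    show "wuc (scale_seq scale) (norm v * K) (\<lambda>n. V (x n))"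
      by (rule C.wuc_image[OF x k.subspace_c0_ideal[OF I] banach_over_scale_seq V_lin V_bound]) simp
    show "V (x n) \<in> c0_ideal \<I>" for n using V_W x(2) .
    show "weak_star_null (scale_seq scale) (c0_ideal \<I>) (M * N) (\<lambda>n w. f n (R w))"
      by (rule weak_star_null_comp[OF f R_lin R_W R_bound \<phi>(3)])
    have "R (V g) = ?sc (\<phi> v) g" for g
      by (rule bcontfun_eqI) (simp add: R V k.apply_scale_seq \<phi>_lin)
    then have "f n (R (V (x n))) = \<phi> v" for n
      using bounded_linear_onD(2)[OF weak_star_nullD(2)[OF f] x(2)] fx by simp
    then show "\<not> (\<lambda>n. f n (R (V (x n)))) \<longlonglongrightarrow> 0"
      using \<phi>(4) by (simp add: LIMSEQ_const_iff)
  qed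
qed

section \<open>Grothendieck spaces\<close>

text \<open>The coordinate functionals of a copy tend to zero in the weak* sense, yet summation over
  \<open>x\<close> is an element of the bidual with value 1 on each of them.\<close>

lemma grothendieck_not_complemented_c0:
  assumes W: "subspace W" and gr: "grothendieck_property scale W"
  shows "\<not> complemented_copy (scale_seq (*)) (c0 :: (nat \<Rightarrow>\<^sub>C 'k) set) scale W"
proof
  assume copy: "complemented_copy (scale_seq (*)) (c0 :: (nat \<Rightarrow>\<^sub>C 'k) set) scale W"
  obtain K x M f where x: "wuc scale K x" "\<And>n. x n \<in> W" and f: "weak_star_null scale W M f"
    and fx: "\<And>m n. f m (x n) = (if m = n then 1 else 0)"
    using complemented_c0D[OF W copy] by blast
  \<comment> \<open>Cutting off outside \<open>W\<close> gives the normal form that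
    \<open>dual_space\<close> demands.\<close>
  define f' where "f' n w = (if w \<in> W then f n w else 0)" for n w
  have f'_W: "f' n w = f n w" if "w \<in> W" for n w using that by (simp add: f'_def)
  have lin: "bounded_linear_on scale (*) W (f' n)" for n
    by (rule bounded_linear_onI[where K = M])
      (simp_all add: f'_def subspace_add[OF W] subspace_scale[OF W] bounded_linear_onD[OF weak_star_nullD(2)[OF f]]
        weak_star_nullD(3)[OF f])
  have f'_dual: "f' n \<in> dual_space scale W" for n
    using lin by (simp add: dual_space_def f'_def)
  have zero_dual: "(\<lambda>_. 0) \<in> dual_space scale W"
    by (auto simp: dual_space_def intro!: bounded_linear_onI[where K = 0])
  have "weak_star_convergent scale W f'"
    unfolding weak_star_convergent_def
    using zero_dual weak_star_nullD(4)[OF f] by (intro bexI[of _ "\<lambda>_. 0"]) (auto simp: f'_W)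
  then obtain g where g: "g \<in> dual_space scale W"
    "\<And>\<psi>. bidual_functional scale W \<psi> \<Longrightarrow> (\<lambda>n. \<psi> (f' n)) \<longlonglongrightarrow> \<psi> g"
    using gr f'_dual unfolding grothendieck_property_def weakly_convergent_def by blast
  have bdd: "bdd_above ((\<lambda>x. norm (h x)) ` {x \<in> W. norm x \<le> 1})" if h: "h \<in> dual_space scale W" for h
  proof -
    have hl: "bounded_linear_on scale (*) W h" using h by (simp add: dual_space_def)
    obtain B where B: "0 \<le> B" "\<And>w. w \<in> W \<Longrightarrow> norm (h w) \<le> B * norm w"
      using bounded_linear_on_bound[OF hl] by blast
    show ?thesis
    proof (rule bdd_aboveI2)
      fix y assume "y \<in> {x \<in> W. norm x \<le> 1}"
      then show "norm (h y) \<le> B" using B(2)[of y] mult_left_mono[OF _ B(1), of "norm y" 1] by simp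
    qed
  qed
  have dual_le: "norm (h w) \<le> dual_norm W h * norm w" if h: "h \<in> dual_space scale W" and w: "w \<in> W" for h w
  proof -
    have hl: "bounded_linear_on scale (*) W h" using h by (simp add: dual_space_def)
    show ?thesis
    proof (cases "w = 0")
      case True
      then show ?thesis using bounded_linear_on_zero[OF banach_over_mult hl subspace_0[OF W]] by simp
    next
      case False
      let ?v = "scale (of_real (inverse (norm w))) w"
      have v: "?v \<in> W" "norm ?v \<le> 1" using False w W by (simp_all add: subspace_scale norm_scale norm_inverse)
      have "norm (h ?v) \<le> dual_norm W h"
        unfolding dual_norm_def by (rule cSUP_upper[OF _ bdd[OF h]]) (use v in simp)
      moreover have "norm (h ?v) = norm (h w) / norm w"
        using w by (simp add: bounded_linear_onD(2)[OF hl] norm_mult norm_inverse divide_inverse mult.commute)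
      ultimately show ?thesis using False by (simp add: divide_le_eq)
    qed
  qed
  have dual_nonneg: "0 \<le> dual_norm W h" if h: "h \<in> dual_space scale W" for h
  proof -
    have "norm (h 0) \<le> dual_norm W h"
      unfolding dual_norm_def by (rule cSUP_upper[OF _ bdd[OF h]]) (use subspace_0[OF W] in simp)
    then show ?thesis using norm_ge_zero order_trans by blast
  qed
  \<comment> \<open>Evaluation at \<open>w\<close> belongs to the bidual, so the weak limit agrees
    with the weak* limit.\<close>
  have "g w = 0" if w: "w \<in> W" for w
  proof -
    have "bidual_functional scale W (\<lambda>h. h w)"
      unfolding bidual_functional_def using dual_le[OF _ w]
      by (auto intro!: exI[of _ "norm w"] simp: mult.commute)
    from g(2)[OF this] have "(\<lambda>n. f n w) \<longlonglongrightarrow> g w" by (simp add: f'_W[OF w])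
    then show ?thesis using weak_star_nullD(4)[OF f w] LIMSEQ_unique by blast
  qed
  then have g0: "g = (\<lambda>_. 0)" using g(1) by (auto simp: dual_space_def fun_eq_iff)
  have h: "summable (\<lambda>n. norm (h (x n)))" "norm (\<Sum>n. h (x n)) \<le> K * dual_norm W h"
    if "h \<in> dual_space scale W" for h
  proof -
    have hl: "bounded_linear_on scale (*) W h" using that by (simp add: dual_space_def)
    show s: "summable (\<lambda>n. norm (h (x n)))"
      by (rule summable_functional(1)[OF x(1) W x(2) hl dual_le[OF that] dual_nonneg[OF that]])
    have "norm (\<Sum>n. h (x n)) \<le> (\<Sum>n. norm (h (x n)))" using s by (rule summable_norm)
    also have "\<dots> \<le> dual_norm W h * K"
      by (rule suminf_le_const[OF s])
        (rule sum_norm_functional_le[OF x(1) W x(2) finite_lessThan hl dual_le[OF that] dual_nonneg[OF that]])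
    finally show "norm (\<Sum>n. h (x n)) \<le> K * dual_norm W h" by (simp add: mult.commute)
  qed
  \<comment> \<open>The sum of the series \<open>x\<close> taken in the bidual; \<open>wuc\<close>
    bounds its norm by \<open>K\<close>.\<close>
  define \<psi> where "\<psi> h = (\<Sum>n. h (x n))" for h :: "'a \<Rightarrow> 'k"
  have "bidual_functional scale W \<psi>"
    unfolding bidual_functional_def
  proof (intro conjI ballI allI)
    fix h h' assume "h \<in> dual_space scale W" "h' \<in> dual_space scale W"
    from this[THEN h(1), THEN summable_norm_cancel] show "\<psi> (\<lambda>x. h x + h' x) = \<psi> h + \<psi> h'"
      unfolding \<psi>_def by (rule suminf_add[symmetric])
  next
    fix c h assume "h \<in> dual_space scale W"
    from this[THEN h(1), THEN summable_norm_cancel] show "\<psi> (\<lambda>x. c * h x) = c * \<psi> h"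
      unfolding \<psi>_def by (rule suminf_mult)
  next
    show "\<exists>K. \<forall>h\<in>dual_space scale W. norm (\<psi> h) \<le> K * dual_norm W h"
      using h(2) unfolding \<psi>_def by blast
  qed
  from g(2)[OF this] have "(\<lambda>n. \<psi> (f' n)) \<longlonglongrightarrow> 0" by (simp add: g0 \<psi>_def)
  moreover have "\<psi> (f' n) = 1" for n
  proof -
    have "\<psi> (f' n) = (\<Sum>m. if m = n then 1 else 0)"
      unfolding \<psi>_def by (intro suminf_cong) (simp add: f'_W x(2) fx)
    also have "\<dots> = 1" using sums_single[of n "\<lambda>_. 1::'k"] by (simp add: sums_iff)
    finally show ?thesis .
  qed
  ultimately show False by (simp add: LIMSEQ_const_iff)
qed

end

section \<open>The dichotomy\<close>

context banach_over
begin

text \<open>By contradiction: without a copy in the space of values, single coordinates contribute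
  nothing in the limit, so the masks can be pushed off to infinity. Their supports inside one
  \<open>C\<close> of the ideal then admit arbitrary bounded coefficients, and
  \<open>phillips_unit_seq\<close> applies.\<close>

lemma complemented_in_space_of_masks:
  assumes I: "ideal_on_omega \<I>" and C: "C \<in> \<I>" "\<And>n. B n \<subseteq> C"
    and x: "wuc (scale_seq scale) K x" and f: "weak_star_null (scale_seq scale) (c0_ideal \<I>) M f"
    and diag: "\<not> (\<lambda>n. f n (mask (B n) (x n))) \<longlonglongrightarrow> 0"
  shows "complemented_copy (scale_seq (*)) (c0 :: (nat \<Rightarrow>\<^sub>C 'k) set) scale UNIV"
proof (rule ccontr)
  assume no_copy: "\<not> complemented_copy (scale_seq (*)) (c0 :: (nat \<Rightarrow>\<^sub>C 'k) set) scale UNIV"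
  let ?sc = "scale_seq (*) :: 'k \<Rightarrow> (nat \<Rightarrow>\<^sub>C 'k) \<Rightarrow> (nat \<Rightarrow>\<^sub>C 'k)"
  interpret S: banach_over "scale_seq scale" by (rule banach_over_scale_seq)
  interpret k: banach_over "(*) :: 'k \<Rightarrow> 'k \<Rightarrow> 'k" by (rule banach_over_mult)
  note f_add = bounded_linear_onD(1)[OF weak_star_nullD(2)[OF f]]
  have mask_W: "mask A w \<in> c0_ideal \<I>" if "A \<subseteq> C" for A and w :: "nat \<Rightarrow>\<^sub>C 'a"
    by (rule c0_ideal_supported[OF I C(1)]) (use that in auto)

  \<comment> \<open>At a fixed coordinate, masking by sets that vary with \<open>n\<close> merely
    deletes terms, so the \<open>wuc\<close> bound survives.\<close>
  have entry_sum: "norm (\<Sum>n\<in>F. scale (a n) (apply_bcontfun (mask (A n) (x n)) i)) \<le> K * c"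
    if "finite F" "\<And>n. n \<in> F \<Longrightarrow> norm (a n) \<le> c" "0 \<le> c" for F a A i c
  proof -
    have "(\<Sum>n\<in>F. scale (a n) (apply_bcontfun (mask (A n) (x n)) i)) =
        (\<Sum>n\<in>{n \<in> F. i \<in> A n}. scale (a n) (apply_bcontfun (x n) i))"
      using that(1) by (intro sum.mono_neutral_cong_right) auto
    also have "\<dots> = apply_bcontfun (\<Sum>n\<in>{n \<in> F. i \<in> A n}. scale_seq scale (a n) (x n)) i"
      by (simp add: apply_bcontfun_sum apply_scale_seq)
    also have "norm \<dots> \<le> norm (\<Sum>n\<in>{n \<in> F. i \<in> A n}. scale_seq scale (a n) (x n))"
      by (rule norm_bounded)
    also have "\<dots> \<le> c * K"
      using that by (intro S.norm_combination_le[OF x]) auto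
    finally show ?thesis by (simp add: mult.commute)
  qed

  \<comment> \<open>Otherwise the \<open>i\<close>-th entries form a \<open>wuc\<close> series in
    the space of values, and the \<open>f n\<close> pulled back to coordinate \<open>i\<close>
    detect it, which gives the excluded copy.\<close>
  have entry: "(\<lambda>n. f n (mask (B n \<inter> {i}) (x n))) \<longlonglongrightarrow> 0" for i
  proof (rule ccontr)
    assume not0: "\<not> (\<lambda>n. f n (mask (B n \<inter> {i}) (x n))) \<longlonglongrightarrow> 0"
    have eq: "mask {i} (const_bcontfun (apply_bcontfun (mask (B n) (x n)) i)) = mask (B n \<inter> {i}) (x n)" for n
      by (rule bcontfun_eqI) auto
    have "complemented_copy ?sc (c0 :: (nat \<Rightarrow>\<^sub>C 'k) set) scale UNIV"
    proof (rule complemented_c0I)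
      show "wuc scale K (\<lambda>n. apply_bcontfun (mask (B n) (x n)) i)"
        unfolding wuc_def using entry_sum[where c = 1 and A = B] by simp
      show "weak_star_null scale UNIV (M * 1) (\<lambda>n v. f n (mask {i} (const_bcontfun v)))"
        by (rule weak_star_null_comp[OF f bounded_linear_on_single(1) single_in_c0_ideal[OF I] bounded_linear_on_single(2)]) simp
      show "\<not> (\<lambda>n. f n (mask {i} (const_bcontfun (apply_bcontfun (mask (B n) (x n)) i)))) \<longlonglongrightarrow> 0"
        unfolding eq by (rule not0)
    qed auto
    then show False using no_copy by blast
  qed
  have initial: "(\<lambda>n. f n (mask (B n \<inter> {..<m}) (x n))) \<longlonglongrightarrow> 0" for m
  proof -
    have "f n (mask (B n \<inter> {..<m}) (x n)) = (\<Sum>i<m. f n (mask (B n \<inter> {i}) (x n)))" for n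
    proof -
      have "mask (B n \<inter> {..<m}) (x n) = (\<Sum>i<m. scale_seq scale 1 (mask (B n \<inter> {i}) (x n)))"
        using mask_finite[of "{..<m}" "mask (B n) (x n)"] by (simp add: Int_commute)
      also have "f n \<dots> = (\<Sum>i<m. 1 * f n (mask (B n \<inter> {i}) (x n)))"
        using C(2) by (intro S.bounded_linear_on_combination[OF banach_over_mult weak_star_nullD(2)[OF f]
          subspace_c0_ideal[OF I]] mask_W) auto
      finally show ?thesis by simp
    qed
    moreover have "(\<lambda>n. \<Sum>i<m. f n (mask (B n \<inter> {i}) (x n))) \<longlonglongrightarrow> 0"
      by (intro tendsto_null_sum entry)
    ultimately show ?thesis by simp
  qed

  obtain \<delta> where \<delta>: "\<delta> > 0" "\<exists>\<^sub>F n in sequentially. \<delta> \<le> norm (f n (mask (B n) (x n)))"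
    using not_tendsto_zeroE[OF diag] by blast
  have "\<forall>\<^sub>F n in sequentially. norm (f n (mask (B n \<inter> {..<m}) (x n))) < \<delta>/2" for m
    using tendstoD[OF initial, of "\<delta>/2"] \<delta>(1) by simp
  then have "\<exists>r::nat \<Rightarrow> nat. strict_mono r \<and> (\<forall>k. \<delta> \<le> norm (f (r k) (mask (B (r k)) (x (r k))))) \<and>
      (\<forall>j k. j < k \<longrightarrow> norm (f (r k) (mask (B (r k) \<inter> {..<k}) (x (r k)))) < \<delta>/2)"
    by (intro frequently_subsequence[OF \<delta>(2)])
  then obtain r :: "nat \<Rightarrow> nat" where r: "strict_mono r"
      "\<And>k. \<delta> \<le> norm (f (r k) (mask (B (r k)) (x (r k))))"
      "\<And>j k. j < k \<Longrightarrow> norm (f (r k) (mask (B (r k) \<inter> {..<k}) (x (r k)))) < \<delta>/2" by blast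
  \<comment> \<open>Removing the coordinates below \<open>k\<close> costs at most \<delta>/2 of the
    value at position \<open>k\<close>.\<close>
  define A where "A k = B (r k) - {..<k}" for k
  define y where "y k = mask (A k) (x (r k))" for k
  have A_C: "A k \<subseteq> C" for k using C(2) by (auto simp: A_def)
  have y_large: "\<delta>/2 \<le> norm (f (r k) (y k))" for k
  proof -
    have "(B (r k) \<inter> {..<k}) \<inter> A k = {}" "(B (r k) \<inter> {..<k}) \<union> A k = B (r k)"
      by (auto simp: A_def)
    then have "mask (B (r k)) (x (r k)) = mask (B (r k) \<inter> {..<k}) (x (r k)) + y k"
      using mask_Un_disjoint unfolding y_def by metis
    moreover have "f (r k) (mask (B (r k) \<inter> {..<k}) (x (r k)) + y k) =
        f (r k) (mask (B (r k) \<inter> {..<k}) (x (r k))) + f (r k) (y k)"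
      unfolding y_def using C(2) A_C by (intro f_add mask_W) auto
    ultimately have split: "f (r k) (mask (B (r k)) (x (r k))) =
        f (r k) (mask (B (r k) \<inter> {..<k}) (x (r k))) + f (r k) (y k)" by simp
    have "norm (f (r k) (mask (B (r k) \<inter> {..<k}) (x (r k)))) \<le> \<delta>/2"
    proof (cases k)
      \<comment> \<open>The bound in \<open>r\<close> is available only for \<open>k\<close> with a
        predecessor; for \<open>k = 0\<close> the mask is empty.\<close>
      case 0
      have "f (r k) 0 = 0"
        by (rule S.bounded_linear_on_zero[OF banach_over_mult weak_star_nullD(2)[OF f]])
          (rule S.subspace_0[OF subspace_c0_ideal[OF I]])
      then show ?thesis using 0 \<delta>(1) by simp
    next
      case (Suc l)
      then show ?thesis using r(3)[of l k] by simp
    qed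
    then show ?thesis
      using r(2)[of k] norm_triangle_ineq[of "f (r k) (mask (B (r k) \<inter> {..<k}) (x (r k)))" "f (r k) (y k)"]
      unfolding split by linarith
  qed

  text \<open>Every entry of \<open>V g\<close> is a finite sum, so \<open>V\<close> is defined on all bounded sequences.\<close>
  define V where "V g = (Bcontfun (\<lambda>i. \<Sum>k\<le>i. scale (apply_bcontfun g k) (apply_bcontfun (y k) i)) :: nat \<Rightarrow>\<^sub>C 'a)" for g
  have V_le: "norm (\<Sum>k\<le>i. scale (apply_bcontfun g k) (apply_bcontfun (y k) i)) \<le> K * norm g" for g i
  proof -
    have "(\<Sum>k\<le>i. scale (apply_bcontfun g k) (apply_bcontfun (y k) i)) =
        (\<Sum>n\<in>r ` {..i}. scale (apply_bcontfun g (inv r n)) (apply_bcontfun (mask (A (inv r n)) (x n)) i))"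
      using strict_mono_imp_inj_on[OF r(1)] by (subst sum.reindex) (auto simp: y_def intro: inj_on_subset)
    also have "norm \<dots> \<le> K * norm g"
      by (rule entry_sum) (auto simp: norm_bounded)
    finally show ?thesis .
  qed
  have V: "apply_bcontfun (V g) i = (\<Sum>k\<le>i. scale (apply_bcontfun g k) (apply_bcontfun (y k) i))" for g i
    unfolding V_def by (subst apply_Bcontfun[OF V_le]) simp
  have V_bound: "norm (V g) \<le> K * norm g" for g by (rule norm_bound) (simp add: V V_le)
  have V_lin: "bounded_linear_on ?sc (scale_seq scale) UNIV V"
    by (rule bounded_linear_onI[OF _ _ V_bound]; rule bcontfun_eqI)
      (simp_all add: V scale_left_distrib sum.distrib apply_scale_seq k.apply_scale_seq scale_sum_right)
  \<comment> \<open>Membership holds even for coefficients that do not tend to zero, because the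
    support stays in \<open>C\<close>.\<close>
  have V_W: "V g \<in> c0_ideal \<I>" for g
    by (rule c0_ideal_supported[OF I C(1)])
      (use A_C in \<open>auto simp: V y_def subset_iff intro!: sum.neutral\<close>)
  \<comment> \<open>For \<open>k > i\<close> the cut-off sum omits the term, but then
    \<open>y k\<close> vanishes at \<open>i\<close>, as \<open>A k\<close> contains no index below
    \<open>k\<close>.\<close>
  have V_unit: "V (unit_seq k) = y k" for k
  proof (rule bcontfun_eqI)
    fix i
    have "apply_bcontfun (V (unit_seq k)) i = (\<Sum>j\<le>i. if j = k then apply_bcontfun (y k) i else 0)"
      unfolding V by (intro sum.cong) auto
    then show "apply_bcontfun (V (unit_seq k)) i = apply_bcontfun (y k) i"
      by (auto simp: y_def A_def)
  qed
  have "weak_star_null ?sc UNIV (M * K) (\<lambda>k g. f (r k) (V g))"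
    by (rule weak_star_null_comp[OF weak_star_null_subseq[OF f r(1)] V_lin V_W V_bound wuc_nonneg[OF x]])
  from phillips_unit_seq[OF this] have "(\<lambda>k. f (r k) (y k)) \<longlonglongrightarrow> 0" by (simp add: V_unit)
  then have "\<forall>\<^sub>F k in sequentially. norm (f (r k) (y k)) < \<delta>/2"
    using tendstoD[of "\<lambda>k. f (r k) (y k)" 0 sequentially "\<delta>/2"] \<delta>(1) by simp
  then obtain k where "norm (f (r k) (y k)) < \<delta>/2" by (auto simp: eventually_sequentially)
  then show False using y_large[of k] by simp
qed

text \<open>Along a subsequence, at least half of the value 1 of \<open>f n (x n)\<close> comes from
  the set \<open>C n\<close> of large entries minus the earlier selected sets. The resulting blocks
  are disjoint, and a bounded disjoint sequence behaves like the scalar sequence of its entrywise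
  norms.\<close>

lemma complemented_in_scalar_of_small_masks:
  assumes I: "ideal_on_omega \<I>"
    and x: "wuc (scale_seq scale) K x" "\<And>n. x n \<in> c0_ideal \<I>"
    and f: "weak_star_null (scale_seq scale) (c0_ideal \<I>) M f" and fx: "\<And>n. f n (x n) = 1"
    and small: "\<And>C B. C \<in> \<I> \<Longrightarrow> (\<And>n. B n \<subseteq> C) \<Longrightarrow> (\<lambda>n. f n (mask (B n) (x n))) \<longlonglongrightarrow> 0"
  shows "complemented_copy (scale_seq (*)) (c0 :: (nat \<Rightarrow>\<^sub>C 'k) set)
    (scale_seq (*)) (c0_ideal \<I> :: (nat \<Rightarrow>\<^sub>C 'k) set)"
proof -
  let ?sc = "scale_seq (*) :: 'k \<Rightarrow> (nat \<Rightarrow>\<^sub>C 'k) \<Rightarrow> (nat \<Rightarrow>\<^sub>C 'k)"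
  let ?W = "c0_ideal \<I> :: (nat \<Rightarrow>\<^sub>C 'k) set"
  interpret S: banach_over "scale_seq scale" by (rule banach_over_scale_seq)
  interpret k: banach_over "(*) :: 'k \<Rightarrow> 'k \<Rightarrow> 'k" by (rule banach_over_mult)
  interpret C: banach_over ?sc by (rule k.banach_over_scale_seq)
  note f_add = bounded_linear_onD(1)[OF weak_star_nullD(2)[OF f]]
  have mask_W: "mask A (x n) \<in> c0_ideal \<I>" for A n by (rule mask_in_c0_ideal[OF I x(2)])
  have M: "0 \<le> M" by (rule weak_star_nullD(1)[OF f])
  \<comment> \<open>Chosen so that the entries below \<epsilon> contribute at most a quarter of the
    value 1; \<open>M + 1\<close> covers \<open>M = 0\<close>.\<close>
  define \<epsilon> where "\<epsilon> = 1 / (4 * (M + 1))"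
  have \<epsilon>: "\<epsilon> > 0" "M * \<epsilon> \<le> 1/4" using M by (auto simp: \<epsilon>_def field_simps)
  define C where "C n = {i. \<epsilon> \<le> norm (apply_bcontfun (x n) i)}" for n
  have C_I: "C n \<in> \<I>" for n unfolding C_def by (rule c0_idealD[OF x(2) \<epsilon>(1)])
  have outside: "norm (f n (mask (- C n) (x n))) \<le> 1/4" for n
  proof -
    have "norm (mask (- C n) (x n)) \<le> \<epsilon>"
      by (rule norm_bound) (use \<epsilon>(1) in \<open>auto simp: C_def\<close>)
    then have "M * norm (mask (- C n) (x n)) \<le> M * \<epsilon>" using M by (rule mult_left_mono)
    then show ?thesis using weak_star_nullD(3)[OF f mask_W, of n "- C n" n] \<epsilon>(2) by simp
  qed
  have ev: "\<forall>\<^sub>F n in sequentially. \<forall>B\<subseteq>E. norm (f n (mask B (x n))) \<le> 1/4" if E: "E \<in> \<I>" for E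
  proof -
    \<comment> \<open>A violating subset is selected for each \<open>n\<close> that has one;
      \<open>small\<close> for this single family gives the bound uniformly over all subsets of
      \<open>E\<close>.\<close>
    define B where "B n = (if \<exists>B\<subseteq>E. 1/4 < norm (f n (mask B (x n)))
      then SOME B. B \<subseteq> E \<and> 1/4 < norm (f n (mask B (x n))) else {})" for n
    have B: "B n \<subseteq> E \<and> 1/4 < norm (f n (mask (B n) (x n)))" if "\<exists>B\<subseteq>E. 1/4 < norm (f n (mask B (x n)))" for n
      using someI_ex[of "\<lambda>B. B \<subseteq> E \<and> 1/4 < norm (f n (mask B (x n)))"] that by (simp add: B_def)
    then have "B n \<subseteq> E" for n by (cases "\<exists>B\<subseteq>E. 1/4 < norm (f n (mask B (x n)))") (auto simp: B_def)
    from small[of E B, OF E this] have "(\<lambda>n. f n (mask (B n) (x n))) \<longlonglongrightarrow> 0" .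
    then have "\<forall>\<^sub>F n in sequentially. norm (f n (mask (B n) (x n))) < 1/4"
      using tendstoD[of "\<lambda>n. f n (mask (B n) (x n))" 0 sequentially "1/4"] by simp
    then show ?thesis
    proof (rule eventually_mono)
      fix n assume lt: "norm (f n (mask (B n) (x n))) < 1/4"
      have "\<not> (\<exists>B\<subseteq>E. 1/4 < norm (f n (mask B (x n))))" using B[of n] lt by auto
      then show "\<forall>B\<subseteq>E. norm (f n (mask B (x n))) \<le> 1/4" by (simp only: not_less[symmetric]) blast
    qed
  qed
  define Q where "Q E n \<longleftrightarrow> (\<forall>B\<subseteq>E. norm (f n (mask B (x n))) \<le> 1/4)" for E n
  \<comment> \<open>As the union runs over all \<open>l \<le> r j\<close>, the condition for
    \<open>j = k - 1\<close> alone covers every set selected before position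
    \<open>k\<close>.\<close>
  have "\<exists>r::nat \<Rightarrow> nat. strict_mono r \<and> (\<forall>k::nat. True) \<and> (\<forall>j k. j < k \<longrightarrow> Q (\<Union>l\<in>{..r j}. C l) (r k))"
  proof (rule frequently_subsequence)
    show "\<forall>\<^sub>F n in sequentially. Q (\<Union>l\<in>{..i}. C l) n" for i
      unfolding Q_def by (intro ev ideal_UN[OF I] C_I) simp
  qed simp
  then obtain r :: "nat \<Rightarrow> nat" where r: "strict_mono r"
    "\<And>j k. j < k \<Longrightarrow> Q (\<Union>l\<in>{..r j}. C l) (r k)" by blast
  define D where "D k = C (r k) - (\<Union>j<k. C (r j))" for k
  have D_disj: "D j \<inter> D k = {}" if "j \<noteq> k" for j k
    using that by (cases j k rule: linorder_cases) (auto simp: D_def)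
  have D_unique: "j = k" if "i \<in> D j" "i \<in> D k" for i j k using D_disj that by blast
  \<comment> \<open>\<open>?x\<close> splits into its small entries, the new block and the overlap
    \<open>?E\<close> with earlier sets; the first and the last take at most 1/4 each from the value
    1.\<close>
  have D_large: "1/2 \<le> norm (f (r k) (mask (D k) (x (r k))))" for k
  proof -
    let ?x = "x (r k)" and ?C = "C (r k)" and ?f = "f (r k)" and ?E = "C (r k) \<inter> (\<Union>j<k. C (r j))"
    have "?x = mask (- ?C) ?x + mask ?C ?x"
      using mask_Un_disjoint[of "- ?C" ?C ?x] by simp
    also have "mask ?C ?x = mask (D k) ?x + mask ?E ?x"
    proof -
      have "D k \<inter> ?E = {}" "D k \<union> ?E = ?C" by (auto simp: D_def)
      then show ?thesis using mask_Un_disjoint by metis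
    qed
    finally have "?f ?x = ?f (mask (- ?C) ?x + (mask (D k) ?x + mask ?E ?x))" by simp
    also have "\<dots> = ?f (mask (- ?C) ?x) + (?f (mask (D k) ?x) + ?f (mask ?E ?x))"
      by (simp add: f_add mask_W S.subspace_add[OF subspace_c0_ideal[OF I]])
    finally have one: "?f (mask (- ?C) ?x) + (?f (mask (D k) ?x) + ?f (mask ?E ?x)) = 1" by (simp add: fx)
    have "norm (?f (mask ?E ?x)) \<le> 1/4"
    proof (cases k)
      case 0
      have "?f 0 = 0"
        by (rule S.bounded_linear_on_zero[OF banach_over_mult weak_star_nullD(2)[OF f]])
          (rule S.subspace_0[OF subspace_c0_ideal[OF I]])
      then show ?thesis using 0 by simp
    next
      case (Suc l)
      have "?E \<subseteq> (\<Union>j\<in>{..r l}. C j)"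
      proof
        fix i assume "i \<in> ?E"
        then obtain j where "j < k" "i \<in> C (r j)" by blast
        moreover have "r j \<le> r l" using \<open>j < k\<close> Suc by (simp add: strict_mono_less_eq[OF r(1)])
        ultimately show "i \<in> (\<Union>j\<in>{..r l}. C j)" by blast
      qed
      then show ?thesis using r(2)[of l k] Suc unfolding Q_def by blast
    qed
    then show ?thesis
      using outside[of "r k"] norm_triangle_ineq[of "?f (mask (D k) ?x)" "?f (mask ?E ?x)"] one
        norm_triangle_ineq[of "?f (mask (- ?C) ?x)" "?f (mask (D k) ?x) + ?f (mask ?E ?x)"]
      by simp
  qed

  text \<open>\<open>u\<close> consists of the directions of the disjoint blocks \<open>mask (D k) (x (r k))\<close> and \<open>h k\<close> of
    their norms, so that \<open>R\<close>, the multiplication by \<open>u\<close>, recovers the blocks.\<close>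
  define u :: "nat \<Rightarrow> 'a" where
    "u i = (if \<exists>k. i \<in> D k then let v = apply_bcontfun (x (r (THE k. i \<in> D k))) i
      in scale (of_real (1 / norm v)) v else 0)" for i
  have u_D: "u i = scale (of_real (1 / norm (apply_bcontfun (x (r k)) i))) (apply_bcontfun (x (r k)) i)"
    if "i \<in> D k" for i k
  proof -
    have "(THE k. i \<in> D k) = k" using that D_unique by (intro the_equality) auto
    then show ?thesis using that by (auto simp: u_def Let_def)
  qed
  have u_le: "norm (u i) \<le> 1" for i
  proof (cases "\<exists>k. i \<in> D k")
    case True
    then obtain k where "i \<in> D k" by blast
    then show ?thesis by (simp add: u_D norm_scale norm_divide)
  qed (simp add: u_def)
  define R where "R g = (Bcontfun (\<lambda>i. scale (apply_bcontfun g i) (u i)) :: nat \<Rightarrow>\<^sub>C 'a)" for g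
  have R_le: "norm (scale (apply_bcontfun g i) (u i)) \<le> norm (apply_bcontfun g i)" for g i
    using mult_left_mono[OF u_le norm_ge_zero] by (simp add: norm_scale)
  have R: "apply_bcontfun (R g) i = scale (apply_bcontfun g i) (u i)" for g i
    unfolding R_def by (subst apply_Bcontfun[OF order_trans[OF R_le norm_bounded]]) simp
  have R_bound: "norm (R g) \<le> 1 * norm g" for g
    by (rule norm_bound) (use order_trans[OF R_le norm_bounded] in \<open>simp add: R\<close>)
  have R_lin: "bounded_linear_on ?sc (scale_seq scale) ?W R"
    by (rule bounded_linear_onI[OF _ _ R_bound]; rule bcontfun_eqI)
      (simp_all add: R scale_left_distrib apply_scale_seq k.apply_scale_seq)
  have R_W: "R g \<in> c0_ideal \<I>" if "g \<in> ?W" for g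
    by (rule c0_ideal_dominated[OF I that]) (simp add: R R_le)

  define h where
    "h k = (Bcontfun (\<lambda>i. if i \<in> D k then of_real (norm (apply_bcontfun (x (r k)) i)) else 0) :: nat \<Rightarrow>\<^sub>C 'k)" for k
  have h: "apply_bcontfun (h k) i = (if i \<in> D k then of_real (norm (apply_bcontfun (x (r k)) i)) else 0)" for k i
    unfolding h_def by (subst apply_Bcontfun[of _ "norm (x (r k))"]) (auto simp: norm_bounded)
  have h_W: "h k \<in> ?W" for k
    by (rule c0_ideal_dominated[OF I x(2)[of "r k"]]) (simp add: h)
  have Rh: "R (h k) = mask (D k) (x (r k))" for k
    by (rule bcontfun_eqI) (auto simp: R h u_D simp flip: of_real_mult)
  show ?thesis
  proof (rule C.complemented_c0I[OF k.subspace_c0_ideal[OF I] closed_c0_ideal[OF I]])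
    \<comment> \<open>By disjointness at most one \<open>h n\<close> is nonzero at each coordinate,
      and its entry there is at most \<open>norm (x (r n))\<close>, hence at most
      \<open>K\<close>.\<close>
    show "wuc ?sc K h"
      unfolding wuc_def
    proof (intro allI impI)
      fix a :: "nat \<Rightarrow> 'k" and F :: "nat set" assume F: "finite F" "\<forall>n\<in>F. norm (a n) \<le> 1"
      show "norm (\<Sum>n\<in>F. ?sc (a n) (h n)) \<le> K"
      proof (rule norm_bound)
        fix i
        have sum_eq: "apply_bcontfun (\<Sum>n\<in>F. ?sc (a n) (h n)) i = (\<Sum>n\<in>F. a n * apply_bcontfun (h n) i)"
          by (simp add: apply_bcontfun_sum k.apply_scale_seq)
        show "norm (apply_bcontfun (\<Sum>n\<in>F. ?sc (a n) (h n)) i) \<le> K"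
        proof (cases "\<exists>k\<in>F. i \<in> D k")
          case True
          then obtain k where k: "k \<in> F" "i \<in> D k" by blast
          have "(\<Sum>n\<in>F. a n * apply_bcontfun (h n) i) = (\<Sum>n\<in>F. if n = k then a k * apply_bcontfun (h k) i else 0)"
            using D_unique k(2) by (intro sum.cong) (auto simp: h)
          also have "\<dots> = a k * apply_bcontfun (h k) i" using F(1) k(1) by simp
          also have "norm \<dots> \<le> 1 * norm (apply_bcontfun (x (r k)) i)"
            unfolding norm_mult using F(2) k by (intro mult_mono) (auto simp: h)
          also have "\<dots> \<le> K"
            using order_trans[OF norm_bounded S.wuc_norm_le[OF x(1)]] by simp
          finally show ?thesis by (simp add: sum_eq)
        next
          case False
          then have "(\<Sum>n\<in>F. a n * apply_bcontfun (h n) i) = 0" by (intro sum.neutral) (auto simp: h)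
          then show ?thesis using wuc_nonneg[OF x(1)] by (simp add: sum_eq)
        qed
      qed
    qed
    show "weak_star_null ?sc ?W (M * 1) (\<lambda>k g. f (r k) (R g))"
      by (rule weak_star_null_comp[OF weak_star_null_subseq[OF f r(1)] R_lin R_W R_bound]) simp_all
    show "\<not> (\<lambda>k. f (r k) (R (h k))) \<longlonglongrightarrow> 0"
    proof
      assume "(\<lambda>k. f (r k) (R (h k))) \<longlonglongrightarrow> 0"
      from tendstoD[OF this, of "1/2"] obtain k where "norm (f (r k) (R (h k))) < 1/2"
        by (auto simp: eventually_sequentially)
      then show False using D_large[of k] by (simp add: Rh)
    qed
  qed (rule h_W)
qed

text \<open>The two cases are whether or not some sets inside one member of the ideal carry values
  that fail to tend to zero.\<close>

lemma complemented_in_c0_ideal_dichotomy: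
  assumes I: "ideal_on_omega \<I>"
    and "complemented_copy (scale_seq (*)) (c0 :: (nat \<Rightarrow>\<^sub>C 'k) set) (scale_seq scale) (c0_ideal \<I>)"
  shows "complemented_copy (scale_seq (*)) (c0 :: (nat \<Rightarrow>\<^sub>C 'k) set)
        (scale_seq (*)) (c0_ideal \<I> :: (nat \<Rightarrow>\<^sub>C 'k) set) \<or>
      complemented_copy (scale_seq (*)) (c0 :: (nat \<Rightarrow>\<^sub>C 'k) set) scale UNIV"
proof -
  interpret S: banach_over "scale_seq scale" by (rule banach_over_scale_seq)
  obtain K x M f where x: "wuc (scale_seq scale) K x" "\<And>n. x n \<in> c0_ideal \<I>"
    and f: "weak_star_null (scale_seq scale) (c0_ideal \<I>) M f"
    and fx: "\<And>m n. f m (x n) = (if m = n then 1 else 0)"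
    using S.complemented_c0D[OF subspace_c0_ideal[OF I] assms(2)] by blast
  show ?thesis
  proof (cases "\<exists>C B. C \<in> \<I> \<and> (\<forall>n. B n \<subseteq> C) \<and> \<not> (\<lambda>n. f n (mask (B n) (x n))) \<longlonglongrightarrow> 0")
    case True
    then show ?thesis using complemented_in_space_of_masks[OF I _ _ x(1) f] by blast
  next
    case False
    then show ?thesis
      by (intro disjI1 complemented_in_scalar_of_small_masks[OF I x f]) (auto simp: fx)
  qed
qed

end

theorem theorem7p4:
  fixes \<I> :: "nat set set"
    and scale :: "'k::{real_normed_field,euclidean_space} \<Rightarrow> 'a::banach \<Rightarrow> 'a"
  assumes "ideal_on_omega \<I>"
    and "banach_over scale"
    and "\<exists>x::'a. x \<noteq> 0"
  shows
    "(complemented_copy (scale_seq (*)) (c0 :: (nat \<Rightarrow>\<^sub>C 'k) set)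
        (scale_seq scale) (c0_ideal \<I> :: (nat \<Rightarrow>\<^sub>C 'a) set)
      \<longleftrightarrow>
      complemented_copy (scale_seq (*)) (c0 :: (nat \<Rightarrow>\<^sub>C 'k) set)
        (scale_seq (*)) (c0_ideal \<I> :: (nat \<Rightarrow>\<^sub>C 'k) set) \<or>
      complemented_copy (scale_seq (*)) (c0 :: (nat \<Rightarrow>\<^sub>C 'k) set)
        scale (UNIV :: 'a set))
     \<and>
     (grothendieck_ideal TYPE('k) \<I> \<longrightarrow>
      (complemented_copy (scale_seq (*)) (c0 :: (nat \<Rightarrow>\<^sub>C 'k) set)
         (scale_seq scale) (c0_ideal \<I> :: (nat \<Rightarrow>\<^sub>C 'a) set)
       \<longleftrightarrow>
       complemented_copy (scale_seq (*)) (c0 :: (nat \<Rightarrow>\<^sub>C 'k) set)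
         scale (UNIV :: 'a set)))"
    (is "(?L \<longleftrightarrow> ?S \<or> ?X) \<and> (?G \<longrightarrow> (?L \<longleftrightarrow> ?X))")
proof -
  interpret banach_over scale by fact
  interpret k: banach_over "(*) :: 'k \<Rightarrow> 'k \<Rightarrow> 'k" by (rule banach_over_mult)
  interpret C: banach_over "scale_seq (*) :: 'k \<Rightarrow> (nat \<Rightarrow>\<^sub>C 'k) \<Rightarrow> (nat \<Rightarrow>\<^sub>C 'k)"
    by (rule k.banach_over_scale_seq)
  obtain v :: 'a where "v \<noteq> 0" using assms(3) by blast
  have "?L \<longleftrightarrow> ?S \<or> ?X"
  proof
    show "?L \<Longrightarrow> ?S \<or> ?X" by (rule complemented_in_c0_ideal_dichotomy[OF assms(1)])
    show "?S \<or> ?X \<Longrightarrow> ?L"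
      using complemented_in_c0_ideal_of_scalar[OF assms(1) \<open>v \<noteq> 0\<close>]
        complemented_in_c0_ideal_of_space[OF assms(1)] by (elim disjE)
  qed
  \<comment> \<open>For a Grothendieck ideal the scalar alternative is excluded, which leaves
    \<open>?X\<close>.\<close>
  moreover have "\<not> ?S" if ?G
    using C.grothendieck_not_complemented_c0[OF k.subspace_c0_ideal[OF assms(1)]] that
    by (simp add: grothendieck_ideal_def)
  ultimately show ?thesis by simp
qed

end
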